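(* Let $C$ be the affine curve over $\mathbb{Q}$ defined by $p(u,v)=0$, where $$p(u,v)=3u^4v^4-8u^4v^3+6u^4v^2-u^4-8u^3v^4+4u^3v^3-8u^3v^2+12u^3v+6u^2v^4-8u^2v^3+4u^2v^2+8u^2v+6u^2+12uv^3+8uv^2+4uv+8u-v^4+6v^2+8v+3.$$ Define $$\mathcal{F}_1(u,v)=\left[\frac{2u}{(u-1)(u+1)},\ \frac{2v}{(v-1)(v+1)},\ \frac{2(v-1)(v+1)(u-1)(u+1)}{(-v+uv-u-1)^2}\right],$$ $$\mathcal{F}_2(u,v)=\left[\frac{2u}{(u-1)(u+1)},\ -\frac{2(u-v)(uv+1)}{(uv+v+1-u)(uv-v+u+1)},\ -\frac{2(uv-v+u+1)(u^3v-u^3-v-1)}{(u-1)(u+1)(uv+v+1-u)^2}\right],$$ $$\mathcal{F}_3(u,v)=\left[-\frac{2v}{(v-1)(v+1)},\ -\frac{2(u-v)(uv+1)}{(uv+v+1-u)(uv-v+u+1)},\ \frac{2(uv+v+1-u)(v^3u-v^3-u-1)}{(uv-v+u+1)^2(v+1)(v-1)}\right].$$ If $(u,v)\in C(\mathbb{Q})$, then for each $i\in\{1,2,3\}$, provided all three entries of $\mathcal{F}_i(u,v)$ are defined, pairwise distinct and nonzero, the set $\{a,b,c\}$ of entries of $\mathcal{F}_i(u,v)=[a,b,c]$ is a rational Diophantine triple whose first two elements $\{a,b\}$ form a strong Diophantine pair. Moreover, each such triple can be extended to a rational Diophantine sextuple in infinitely many ways, i.e. there are infinitely many sets $\{d,e,f\}$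 of rationals such that $\{a,b,c,d,e,f\}$ is a rational Diophantine sextuple.
   Context: A rational Diophantine $m$-tuple is a set of $m$ distinct nonzero rationals $\{a_1,\dots,a_m\}$ such that $a_ia_j+1$ is a square of a rational number for all $1\le i<j\le m$. A rational Diophantine $m$-tuple is strong if in addition $a_i^2+1$ is a rational square for every $i$; in particular a strong Diophantine pair is a pair $\{a,b\}$ of distinct nonzero rationals with $ab+1$, $a^2+1$, $b^2+1$ all rational squares. *)

theory Defs
  imports Complex_Main "HOL-Computational_Algebra.Nth_Powers"
begin

definition rational_diophantine_tuple :: "nat \<Rightarrow> rat set \<Rightarrow> bool" where
  "rational_diophantine_tuple m S \<longleftrightarrow>
     finite S \<and> card S = m \<and> 0 \<notin> S \<and>
     (\<forall>a\<in>S. \<forall>b\<in>S. a \<noteq> b \<longrightarrow> is_square (a * b + 1))"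

definition strong_diophantine_tuple :: "nat \<Rightarrow> rat set \<Rightarrow> bool" where
  "strong_diophantine_tuple m S \<longleftrightarrow>
     rational_diophantine_tuple m S \<and> (\<forall>a\<in>S. is_square (a ^ 2 + 1))"

definition curve_poly :: "rat \<Rightarrow> rat \<Rightarrow> rat" where
  "curve_poly u v =
     3*u^4*v^4 - 8*u^4*v^3 + 6*u^4*v^2 - u^4 - 8*u^3*v^4 + 4*u^3*v^3 - 8*u^3*v^2 + 12*u^3*v
     + 6*u^2*v^4 - 8*u^2*v^3 + 4*u^2*v^2 + 8*u^2*v + 6*u^2 + 12*u*v^3 + 8*u*v^2 + 4*u*v + 8*u
     - v^4 + 6*v^2 + 8*v + 3"

definition C_rational_points :: "(rat \<times> rat) set" where
  "C_rational_points = {(u, v). curve_poly u v = 0}"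

text \<open>In HOL division is total with x / 0 = 0. The quotient \<open>n \<div> d\<close> below is undefined
  (\<^const>\<open>None\<close>) when its denominator vanishes, so that an entry of \<open>F1\<close>, \<open>F2\<close>, \<open>F3\<close> is defined
  exactly when it has the form \<^term>\<open>Some x\<close>.\<close>

definition partial_divide :: "rat \<Rightarrow> rat \<Rightarrow> rat option"  (infixl \<open>\<div>\<close> 70) where
  "n \<div> d = (if d = 0 then None else Some (n / d))"

type_synonym partial_triple = "rat option \<times> rat option \<times> rat option"

definition F1 :: "rat \<Rightarrow> rat \<Rightarrow> partial_triple" where
  "F1 u v =
     ((2*u) \<div> ((u - 1)*(u + 1)),
      (2*v) \<div> ((v - 1)*(v + 1)),
      (2*(v - 1)*(v + 1)*(u - 1)*(u + 1)) \<div> ((- v + u*v - u - 1)^2))"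

definition F2 :: "rat \<Rightarrow> rat \<Rightarrow> partial_triple" where
  "F2 u v =
     ((2*u) \<div> ((u - 1)*(u + 1)),
      (- (2*(u - v)*(u*v + 1))) \<div> ((u*v + v + 1 - u)*(u*v - v + u + 1)),
      (- (2*(u*v - v + u + 1)*(u^3*v - u^3 - v - 1)))
        \<div> ((u - 1)*(u + 1)*(u*v + v + 1 - u)^2))"

definition F3 :: "rat \<Rightarrow> rat \<Rightarrow> partial_triple" where
  "F3 u v =
     ((- (2*v)) \<div> ((v - 1)*(v + 1)),
      (- (2*(u - v)*(u*v + 1))) \<div> ((u*v + v + 1 - u)*(u*v - v + u + 1)),
      (2*(u*v + v + 1 - u)*(v^3*u - v^3 - u - 1))
        \<div> ((u*v - v + u + 1)^2*(v + 1)*(v - 1)))"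

end

theory Submission
  imports Defs "HOL-Computational_Algebra.Polynomial"
begin

text \<open>
  Write \<open>r\<^sup>2 = ab + 1\<close>, \<open>s\<^sup>2 = ac + 1\<close>, \<open>t\<^sup>2 = bc + 1\<close> and let \<open>E\<close> be the elliptic curve
  \<open>y\<^sup>2 = (x + ab)(x + ac)(x + bc)\<close> with the points \<open>P = (0, abc)\<close> and \<open>S = (1, rst)\<close>. The
  equation of \<open>C\<close> says that \<open>rs + rt + st = 0\<close> for suitable signs of the roots, that is, \<open>S\<close>
  has order 3. A rational \<open>d = x(T)/(abc)\<close> extends the triple if \<open>T \<in> P + 2E(\<rat>)\<close>, and since
  \<open>3S = O\<close> the three points \<open>T\<close>, \<open>T + S\<close>, \<open>T - S\<close> together extend it to a sextuple, up to
  finitely many degenerate \<open>T\<close>.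

  It remains to see that \<open>2E(\<rat>)\<close> is infinite. As \<open>a\<^sup>2 + 1\<close> and \<open>b\<^sup>2 + 1\<close> are squares, the coset
  \<open>P + 2E(\<rat>)\<close> also contains points \<open>A\<close>, \<open>B\<close> with abscissae \<open>a\<^sup>2bc\<close> and \<open>ab\<^sup>2c\<close>. A case
  distinction on the 2-adic valuations of \<open>a\<close>, \<open>b\<close>, \<open>c\<close> shows that one of the points \<open>2P\<close>,
  \<open>2A\<close>, \<open>2B\<close>, \<open>P - A\<close>, \<open>P - B\<close>, \<open>A - B\<close> is 2-adically so close to \<open>O\<close> that each further
  doubling lowers the valuation of the abscissa; hence it has infinite order. This takes the place
  of Mazur's theorem on torsion.
\<close>

section \<open>The 2-adic valuation of rational numbers\<close>

text \<open>The valuation is encoded by two relations instead of a function: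
  \<open>val_ge k 0\<close> holds for every \<open>k\<close>, standing for infinite valuation, while
  \<open>has_val\<close> excludes 0.\<close>

definition val_ge :: "int \<Rightarrow> rat \<Rightarrow> bool" where
  "val_ge k x \<longleftrightarrow> (\<exists>p q::int. odd q \<and> x = 2 powi k * (of_int p / of_int q))"

definition has_val :: "int \<Rightarrow> rat \<Rightarrow> bool" where
  "has_val k x \<longleftrightarrow> (\<exists>p q::int. odd p \<and> odd q \<and> x = 2 powi k * (of_int p / of_int q))"

lemma val_geI: "odd q \<Longrightarrow> x = 2 powi k * (of_int p / of_int q) \<Longrightarrow> val_ge k x"
  unfolding val_ge_def by blast

lemma has_valI: "odd p \<Longrightarrow> odd q \<Longrightarrow> x = 2 powi k * (of_int p / of_int q) \<Longrightarrow> has_val k x"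
  unfolding has_val_def by blast

lemma has_val_imp_ge: "has_val k x \<Longrightarrow> val_ge k x"
  unfolding has_val_def val_ge_def by blast

lemma val_ge_mono:
  assumes "val_ge l x" "k \<le> l" shows "val_ge k x"
proof -
  obtain p q where q: "odd q" "x = 2 powi l * (of_int p / of_int q)"
    using assms(1) unfolding val_ge_def by blast
  have "2 powi l = (2 powi k * 2 powi (l - k) :: rat)"
    by (simp add: power_int_diff)
  also have "(2::rat) powi (l - k) = of_int (2 ^ nat (l - k))"
    using assms(2) by (simp add: power_int_def)
  finally have "x = 2 powi k * (of_int (2 ^ nat (l - k) * p) / of_int q)"
    using q by simp
  with q(1) show ?thesis by (rule val_geI)
qed

lemma has_val_ge: "has_val l x \<Longrightarrow> k \<le> l \<Longrightarrow> val_ge k x"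
  by (meson has_val_imp_ge val_ge_mono)

lemma val_ge_add:
  assumes "val_ge k x" "val_ge k y" shows "val_ge k (x + y)"
proof -
  obtain p q where q: "odd q" "x = 2 powi k * (of_int p / of_int q)"
    using assms(1) unfolding val_ge_def by blast
  obtain p' q' where q': "odd q'" "y = 2 powi k * (of_int p' / of_int q')"
    using assms(2) unfolding val_ge_def by blast
  have "q \<noteq> 0" "q' \<noteq> 0" using q q' by auto
  then have "x + y = 2 powi k * (of_int (p * q' + p' * q) / of_int (q * q'))"
    using q q' by (simp add: field_simps)
  then show ?thesis by (rule val_geI[rotated]) (use q q' in auto)
qed

lemma val_ge_minus: "val_ge k x \<Longrightarrow> val_ge k (- x)"
  unfolding val_ge_def by (metis minus_divide_left mult_minus_right of_int_minus)

lemma has_val_minus: "has_val k x \<Longrightarrow> has_val k (- x)"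
  unfolding has_val_def by (metis even_minus minus_divide_left mult_minus_right of_int_minus)

lemma val_ge_diff: "val_ge k x \<Longrightarrow> val_ge k y \<Longrightarrow> val_ge k (x - y)"
  using val_ge_add[of k x "- y"] val_ge_minus by auto

lemma val_ge_mult:
  assumes "val_ge k x" "val_ge l y" shows "val_ge (k + l) (x * y)"
proof -
  obtain p q where q: "odd q" "x = 2 powi k * (of_int p / of_int q)"
    using assms(1) unfolding val_ge_def by blast
  obtain p' q' where q': "odd q'" "y = 2 powi l * (of_int p' / of_int q')"
    using assms(2) unfolding val_ge_def by blast
  have "x * y = 2 powi (k + l) * (of_int (p * p') / of_int (q * q'))"
    using q q' by (simp add: power_int_add)
  then show ?thesis by (rule val_geI[rotated]) (use q q' in auto)
qed

lemma has_val_mult: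
  assumes "has_val k x" "has_val l y" shows "has_val (k + l) (x * y)"
proof -
  obtain p q where q: "odd p" "odd q" "x = 2 powi k * (of_int p / of_int q)"
    using assms(1) unfolding has_val_def by blast
  obtain p' q' where q': "odd p'" "odd q'" "y = 2 powi l * (of_int p' / of_int q')"
    using assms(2) unfolding has_val_def by blast
  have "x * y = 2 powi (k + l) * (of_int (p * p') / of_int (q * q'))"
    using q q' by (simp add: power_int_add)
  then show ?thesis by (rule has_valI[rotated 2]) (use q q' in auto)
qed

lemma has_val_nonzero: "has_val k x \<Longrightarrow> x \<noteq> 0"
  unfolding has_val_def by auto

lemma has_val_inverse:
  assumes "has_val k x" shows "has_val (- k) (1 / x)"
proof -
  obtain p q where q: "odd p" "odd q" "x = 2 powi k * (of_int p / of_int q)"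
    using assms(1) unfolding has_val_def by blast
  have "1 / x = 2 powi (- k) * (of_int q / of_int p)"
    using q by (simp add: power_int_minus field_simps)
  then show ?thesis by (rule has_valI[rotated 2]) (use q in auto)
qed

lemma has_val_divide: "has_val k x \<Longrightarrow> has_val l y \<Longrightarrow> has_val (k - l) (x / y)"
  using has_val_mult[OF _ has_val_inverse, of k x l y] by simp

lemma has_val_power2: "has_val k x \<Longrightarrow> has_val (2 * k) (x\<^sup>2)"
  using has_val_mult[of k x k x] by (simp add: power2_eq_square)

lemma has_val_one: "has_val 0 1"
  by (rule has_valI[of 1 1]) auto

lemma has_val_two: "has_val 1 2"
  by (rule has_valI[of 1 1]) auto

lemma has_val_four: "has_val 2 4"
  using has_val_mult[OF has_val_two has_val_two] by simp

lemma has_val_add: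
  assumes "has_val k x" "val_ge l y" "k < l" shows "has_val k (x + y)"
proof -
  obtain p q where q: "odd p" "odd q" "x = 2 powi k * (of_int p / of_int q)"
    using assms(1) unfolding has_val_def by blast
  have "val_ge (k + 1) y" using assms(2,3) by (meson val_ge_mono zless_imp_add1_zle)
  then obtain p' q' where q': "odd q'" "y = 2 powi (k + 1) * (of_int p' / of_int q')"
    unfolding val_ge_def by blast
  have "q \<noteq> 0" "q' \<noteq> 0" using q q' by auto
  then have "x + y = 2 powi k * (of_int (p * q' + 2 * p' * q) / of_int (q * q'))"
    using q q' by (simp add: field_simps power_int_add)
  then show ?thesis by (rule has_valI[rotated 2]) (use q q' in auto)
qed

lemma has_val_diff: "has_val k x \<Longrightarrow> val_ge l y \<Longrightarrow> k < l \<Longrightarrow> has_val k (x - y)"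
  using has_val_add[of k x l "- y"] val_ge_minus by auto

text \<open>Otherwise \<open>x - x\<close> would have valuation \<open>k\<close>.\<close>

lemma has_val_not_ge: "has_val k x \<Longrightarrow> k < l \<Longrightarrow> \<not> val_ge l x"
  using has_val_diff[of k x l x] has_val_nonzero by fastforce

lemma has_val_unique: "has_val k x \<Longrightarrow> has_val l x \<Longrightarrow> k = l"
  by (metis has_val_imp_ge has_val_not_ge linorder_cases)

lemma val_ge_cases:
  assumes "val_ge k x" shows "has_val k x \<or> val_ge (k + 1) x"
proof -
  obtain p q where q: "odd q" "x = 2 powi k * (of_int p / of_int q)"
    using assms(1) unfolding val_ge_def by blast
  show ?thesis
  proof (cases "even p")
    case True
    then obtain p' where "p = 2 * p'" by blast
    then have "x = 2 powi (k + 1) * (of_int p' / of_int q)"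
      using q by (simp add: power_int_add)
    then show ?thesis using val_geI q by blast
  next
    case False
    then show ?thesis using has_valI q by blast
  qed
qed

lemma has_val_add_same:
  assumes "has_val k x" "has_val k y" shows "val_ge (k + 1) (x + y)"
proof -
  obtain p q where q: "odd p" "odd q" "x = 2 powi k * (of_int p / of_int q)"
    using assms(1) unfolding has_val_def by blast
  obtain p' q' where q': "odd p'" "odd q'" "y = 2 powi k * (of_int p' / of_int q')"
    using assms(2) unfolding has_val_def by blast
  have "even (p * q' + p' * q)" using q q' by auto
  then obtain z where z: "p * q' + p' * q = 2 * z" by blast
  have nz: "q \<noteq> 0" "q' \<noteq> 0" using q q' by auto
  then have "x + y = 2 powi k * (of_int (p * q' + p' * q) / of_int (q * q'))"
    using q q' by (simp add: field_simps)
  also have "\<dots> = 2 powi (k + 1) * (of_int z / of_int (q * q'))"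
    unfolding z by (simp add: power_int_add)
  finally show ?thesis by (rule val_geI[rotated]) (use q q' in auto)
qed

lemma has_val_exists:
  assumes "x \<noteq> 0" obtains k where "has_val k x"
proof -
  obtain m n :: int where mn: "n > 0" "x = of_int m / of_int n"
    by (metis Fract_of_int_quotient Rat_cases_nonzero of_int_0 div_0 divide_eq_0_iff Rat_cases)
  then have "m \<noteq> 0" "n \<noteq> 0" using assms by auto
  moreover have "\<exists>i z'. z = 2 ^ i * z' \<and> odd z'" if "z \<noteq> 0" for z :: int
    by (rule multiplicity_decompose'[of z 2]) (use that in auto)
  ultimately obtain i j m' n' where "m = 2 ^ i * m'" "odd m'" "n = 2 ^ j * n'" "odd n'"
    by metis
  then have "x = 2 powi (int i - int j) * (of_int m' / of_int n')"
    using mn by (simp add: power_int_diff)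
  then show ?thesis using that has_valI \<open>odd m'\<close> \<open>odd n'\<close> by blast
qed

lemma has_val_of_square:
  assumes "has_val k (x\<^sup>2)" obtains l where "has_val l x" "k = 2 * l"
  by (metis assms has_val_exists has_val_nonzero has_val_power2 has_val_unique power_zero_numeral)

text \<open>Odd squares are 1 modulo 8, because \<open>i * (i + 1)\<close> is even.\<close>

lemma odd_square_minus_one:
  assumes "has_val 0 x" shows "val_ge 3 (x\<^sup>2 - 1)"
proof -
  obtain p q where q: "odd p" "odd q" "x = of_int p / of_int q"
    using assms(1) unfolding has_val_def by auto
  have "8 dvd p\<^sup>2 - q\<^sup>2"
  proof -
    obtain i j where "p = 2 * i + 1" "q = 2 * j + 1" using q by (meson oddE)
    moreover have "even (i * (i + 1))" "even (j * (j + 1))" by auto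
    then obtain k l where "i * (i + 1) = 2 * k" "j * (j + 1) = 2 * l" by (meson evenE)
    ultimately have "p\<^sup>2 - q\<^sup>2 = 8 * (k - l)" by (simp add: power2_eq_square algebra_simps)
    then show ?thesis by simp
  qed
  then obtain z where z: "p\<^sup>2 - q\<^sup>2 = 8 * z" by blast
  have "q \<noteq> 0" using q by auto
  then have "x\<^sup>2 - 1 = of_int (p\<^sup>2 - q\<^sup>2) / of_int (q\<^sup>2)"
    unfolding q(3) by (simp add: power_divide diff_divide_distrib)
  also have "\<dots> = 2 powi 3 * (of_int z / of_int (q\<^sup>2))"
    unfolding z by simp
  finally show ?thesis by (rule val_geI[rotated]) (use q in auto)
qed

text \<open>Each signed sum differs from the full sum by twice a summand, which has valuation above
  \<open>k\<close>.\<close>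

lemma has_val_signed_sums:
  assumes "val_ge k x" "val_ge k y" "val_ge k z" "has_val k (x + y + z)"
  shows "has_val k (y + z - x)" "has_val k (x + z - y)" "has_val k (x + y - z)"
proof -
  have "val_ge (k + 1) (2 * u)" if "val_ge k u" for u
    using val_ge_mult[OF has_val_imp_ge[OF has_val_two] that] by (simp add: add.commute)
  then have *: "has_val k (x + y + z - 2 * u)" if "val_ge k u" for u
    using that by (intro has_val_diff[OF assms(4)]) auto
  show "has_val k (y + z - x)" using *[OF assms(1)] by (simp add: algebra_simps)
  show "has_val k (x + z - y)" using *[OF assms(2)] by (simp add: algebra_simps)
  show "has_val k (x + y - z)" using *[OF assms(3)] by (simp add: algebra_simps)
qed

text \<open>Sum and difference both have valuation at least \<open>k + 1\<close>, and they differ by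
  \<open>2*x\<close>, which has exactly \<open>k + 1\<close>. This is used to choose signs of square
  roots.\<close>

lemma has_val_add_or_diff:
  assumes "has_val k x" "has_val k y"
  shows "has_val (k + 1) (x + y) \<or> has_val (k + 1) (y - x)"
proof (rule disjCI)
  assume "\<not> has_val (k + 1) (y - x)"
  then have "val_ge (k + 1 + 1) (y - x)"
    using has_val_add_same[OF assms(2) has_val_minus[OF assms(1)]]
      val_ge_cases[of "k + 1" "y - x"] by simp
  moreover have "has_val (k + 1) (2 * x)"
    using has_val_mult[OF has_val_two assms(1)] by (simp add: add.commute)
  ultimately have "has_val (k + 1) (2*x + (y - x))" by (intro has_val_add) auto
  then show "has_val (k + 1) (x + y)" by (simp add: algebra_simps)
qed

lemma has_val_add_three:
  assumes "has_val k x" "has_val k y" "has_val k z" shows "has_val k (x + y + z)"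
  using has_val_add[OF assms(3) has_val_add_same[OF assms(1,2)]] by (simp add: ac_simps)

text \<open>Squares modulo 8 exclude -1, 0 and 1. For 0 the square \<open>w\<^sup>2\<close> would
  have valuation 1; for 1 and -1 two odd squares would have a difference of valuation 2.\<close>

lemma val_of_strong:
  assumes w: "w\<^sup>2 = a\<^sup>2 + 1" and a: "has_val k a" shows "k \<ge> 2 \<or> k \<le> -2"
proof (rule ccontr)
  assume "\<not> ?thesis"
  then consider "k = 0" | "k = 1" | "k = -1" by linarith
  then show False
  proof cases
    case 1
    then have "val_ge 3 (a\<^sup>2 - 1)" using odd_square_minus_one a by simp
    then have "has_val 1 (2 + (a\<^sup>2 - 1))" by (intro has_val_add[OF has_val_two]) auto
    then have "has_val 1 (w\<^sup>2)" unfolding w by (simp add: algebra_simps)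
    then show False by (elim has_val_of_square) presburger
  next
    case 2
    then have a2: "has_val 2 (a\<^sup>2)" using has_val_power2[OF a] by simp
    then have "has_val 0 (1 + a\<^sup>2)" by (intro has_val_add[OF has_val_one has_val_imp_ge]) auto
    then have "has_val 0 (w\<^sup>2)" unfolding w by (simp add: add.commute)
    then have "has_val 0 w" by (elim has_val_of_square) simp
    then have "val_ge 3 (a\<^sup>2)" using odd_square_minus_one[of w] unfolding w by simp
    then show False using has_val_not_ge[OF a2, of 3] by simp
  next
    case 3
    then have a2: "has_val (-2) (a\<^sup>2)" using has_val_power2[OF a] by simp
    then have "has_val (-2) (w\<^sup>2)"
      unfolding w by (intro has_val_add[OF _ has_val_imp_ge[OF has_val_one]]) auto
    then have "has_val (-1) w" by (elim has_val_of_square) simp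
    then have "has_val 0 (2*w)" "has_val 0 (2*a)"
      using has_val_mult[OF has_val_two] a 3 by fastforce+
    then have "val_ge 3 (((2*w)\<^sup>2 - 1) - ((2*a)\<^sup>2 - 1))"
      by (intro val_ge_diff odd_square_minus_one)
    then have "val_ge 3 4" unfolding power_mult_distrib w by (simp add: algebra_simps)
    then show False using has_val_not_ge[OF has_val_four, of 3] by simp
  qed
qed

lemma has_val_sqrt_neg:
  assumes "w\<^sup>2 = x + 1" "has_val (2*k) x" "k < 0" shows "has_val k w"
proof -
  have "has_val (2*k) (w\<^sup>2)"
    unfolding assms(1) using assms(2,3) by (intro has_val_add[OF _ has_val_imp_ge[OF has_val_one]]) auto
  then show ?thesis by (elim has_val_of_square) simp
qed

lemma has_val_sqrt_pos:
  assumes "w\<^sup>2 = x + 1" "val_ge k x" "k > 0" shows "has_val 0 w"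
proof -
  have "has_val 0 (w\<^sup>2)"
    unfolding assms(1) using has_val_add[OF has_val_one assms(2,3)] by (simp add: add.commute)
  then show ?thesis by (elim has_val_of_square) simp
qed

text \<open>The product of \<open>w - a\<close> and \<open>w + a\<close> is 1. After a choice of
  sign, \<open>w + a\<close> has valuation exactly \<open>k + 1\<close>, which determines that of
  \<open>w - a\<close>.\<close>

lemma sqrt_near_large:
  assumes "w\<^sup>2 = a\<^sup>2 + 1" "has_val k a" "k < 0"
  obtains w' where "w'\<^sup>2 = a\<^sup>2 + 1" "has_val k w'" "has_val (- (k + 1)) (w' - a)"
proof -
  have wk: "has_val k w"
    using has_val_sqrt_neg[OF assms(1) has_val_power2[OF assms(2)] assms(3)] .
  have "has_val (k + 1) (w + a) \<or> has_val (k + 1) (- w + a)"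
    using has_val_add_or_diff[OF wk assms(2)] by (simp add: algebra_simps)
  then obtain w' where w': "w'\<^sup>2 = a\<^sup>2 + 1" "has_val k w'" "has_val (k + 1) (w' + a)"
    using assms(1) wk has_val_minus by (metis power2_minus)
  have "(w' - a)*(w' + a) = 1" using w'(1) by algebra
  then have "w' - a = 1 / (w' + a)" using has_val_nonzero[OF w'(3)] by (simp add: eq_divide_eq)
  then show ?thesis using that w' has_val_inverse by metis
qed

text \<open>The same choice of sign, now with \<open>(w - 1)*(w + 1) = b\<^sup>2\<close>.\<close>

lemma sqrt_near_one:
  assumes "w\<^sup>2 = b\<^sup>2 + 1" "has_val k b" "k > 0"
  obtains w' where "w'\<^sup>2 = b\<^sup>2 + 1" "has_val (2*k - 1) (w' - 1)"
proof -
  have b2: "has_val (2*k) (b\<^sup>2)" using has_val_power2[OF assms(2)] .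
  have wk: "has_val 0 w"
    using has_val_sqrt_pos[OF assms(1) has_val_imp_ge[OF b2]] assms(3) by simp
  have "has_val 1 (w + 1) \<or> has_val 1 (- w + 1)"
    using has_val_add_or_diff[OF wk has_val_one] by (simp add: algebra_simps)
  then obtain w' where w': "w'\<^sup>2 = b\<^sup>2 + 1" "has_val 1 (w' + 1)"
    using assms(1) by (metis power2_minus)
  have "(w' - 1)*(w' + 1) = b\<^sup>2" using w'(1) by algebra
  then have "w' - 1 = b\<^sup>2 / (w' + 1)" using has_val_nonzero[OF w'(2)] by (simp add: eq_divide_eq)
  then show ?thesis using that w' has_val_divide[OF b2] by metis
qed


section \<open>Sextuples from a point of order 3\<close>

text \<open>
  If the roots of \<open>ab + 1, \<dots>, cd + 1\<close> have product \<open>Z\<close> and \<open>d = x(T)/(abc)\<close>, then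
  \<open>x(T \<plusminus> S)/(abc) = (ext_num a b c d \<plusminus> 2Z)/(abcd - 1)\<^sup>2\<close> (Dujella's regular quintuples).
\<close>

definition ext_num :: "rat \<Rightarrow> rat \<Rightarrow> rat \<Rightarrow> rat \<Rightarrow> rat" where
  "ext_num a b c d = (a + b + c + d) * (a*b*c*d + 1) + 2*(a*b*c + a*b*d + a*c*d + b*c*d)"

text \<open>By this symmetry \<open>ext_square\<close> applies with any of the four numbers in first
  place.\<close>

lemma ext_num_swap:
  fixes a b c d :: rat
  shows "ext_num b a c d = ext_num a b c d" "ext_num c a b d = ext_num a b c d"
  "ext_num d a b c = ext_num a b c d"
  unfolding ext_num_def by algebra+

text \<open>After division by \<open>(a*b*c*d - 1)\<^sup>2\<close> this exhibits the root of
  \<open>a*e + 1\<close> for a new element \<open>e\<close>. Changing the sign of one root gives the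
  other new element.\<close>

lemma ext_square:
  fixes a b c d :: rat
  assumes "p\<^sup>2 = a*b + 1" "q\<^sup>2 = a*c + 1" "k\<^sup>2 = a*d + 1"
    and "l\<^sup>2 = b*c + 1" "m\<^sup>2 = b*d + 1" "n\<^sup>2 = c*d + 1"
  shows "(p*q*k + a*(l*m*n))\<^sup>2 =
    a * (ext_num a b c d + 2*(p*q*k*l*m*n)) + (a*b*c*d - 1)\<^sup>2"
proof -
  have "(p*q*k + a*(l*m*n))\<^sup>2 = p\<^sup>2*q\<^sup>2*k\<^sup>2 + a\<^sup>2*(l\<^sup>2*m\<^sup>2*n\<^sup>2) + 2*a*(p*q*k*l*m*n)"
    by algebra
  also have "\<dots> = a * (ext_num a b c d + 2*(p*q*k*l*m*n)) + (a*b*c*d - 1)\<^sup>2"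
    unfolding assms ext_num_def by algebra
  finally show ?thesis .
qed

text \<open>Up to the factor \<open>(a*b*c*d - 1)^4\<close> the left side is the product of the two
  new elements. The last factor on the right vanishes exactly for regular quadruples.\<close>

lemma ext_prod:
  fixes a b c d :: rat
  shows "(ext_num a b c d)\<^sup>2 - 4*((a*b+1)*(a*c+1)*(b*c+1)*(a*d+1)*(b*d+1)*(c*d+1))
    = (a*b*c*d - 1)\<^sup>2 * ((a + b - c - d)\<^sup>2 - 4*(a*b+1)*(c*d+1))"
  unfolding ext_num_def by algebra

lemma finite_quartic_roots:
  fixes p :: "rat \<Rightarrow> rat"
  assumes "\<And>x. p x = c0 + c1*x + c2*x^2 + c3*x^3 + c4*x^4"
    and "c0 \<noteq> 0 \<or> c1 \<noteq> 0 \<or> c2 \<noteq> 0 \<or> c3 \<noteq> 0 \<or> c4 \<noteq> 0"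
  shows "finite {x. p x = 0}"
proof -
  have "[:c0, c1, c2, c3, c4:] \<noteq> 0" using assms(2) by auto
  from poly_roots_finite[OF this] show ?thesis
    by (simp add: assms(1) power_numeral_reduce algebra_simps)
qed

text \<open>The roots are parameters because \<open>rel\<close> depends on their signs.\<close>

locale order3_triple =
  fixes a b c r s t :: rat
  assumes nonzero: "a \<noteq> 0" "b \<noteq> 0" "c \<noteq> 0"
    and distinct: "a \<noteq> b" "a \<noteq> c" "b \<noteq> c"
    and r: "r\<^sup>2 = a*b + 1" and s: "s\<^sup>2 = a*c + 1" and t: "t\<^sup>2 = b*c + 1"
    and rel: "r*s + r*t + s*t = 0"
begin

text \<open>
  For fixed \<open>d\<close> the roots in \<open>e\<close> of this quadratic polynomial are \<open>x(T \<plusminus> S)/(abc)\<close>, where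
  \<open>d = x(T)/(abc)\<close>. It is symmetric in \<open>d\<close> and \<open>e\<close>, so each value of \<open>e\<close> arises from at
  most two \<open>d\<close>.
\<close>

definition ext_quad :: "rat \<Rightarrow> rat \<Rightarrow> rat" where
  "ext_quad d e = (e * (a*b*c*d - 1))\<^sup>2 - 2*e*ext_num a b c d
     + ((a + b - c - d)\<^sup>2 - 4*(a*b+1)*(c*d+1))"

text \<open>If one root vanishes, \<open>rel\<close> makes a second one vanish, so two of the
  products \<open>a*b\<close>, \<open>a*c\<close>, \<open>b*c\<close> coincide.\<close>

lemma rst_nonzero: "r*s*t \<noteq> 0"
proof
  assume "r*s*t = 0"
  then have "r\<^sup>2 = 0 \<and> s\<^sup>2 = 0 \<or> r\<^sup>2 = 0 \<and> t\<^sup>2 = 0 \<or> s\<^sup>2 = 0 \<and> t\<^sup>2 = 0"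
    using rel by auto
  then have "a*b = a*c \<or> a*b = b*c \<or> a*c = b*c" unfolding r s t by linarith
  then show False using nonzero distinct by auto
qed

text \<open>As a polynomial in \<open>d\<close> this has leading coefficient \<open>c2\<close>. If
  that is 0, then \<open>e\<close> is the inverse of \<open>a*b*c\<close> and the linear coefficient
  is a nonzero multiple of the square of \<open>r*s*t\<close>.\<close>

lemma finite_ext_quad_roots: "finite {d. ext_quad d e = 0}"
proof -
  define c0 where "c0 = e\<^sup>2 - 2*e*(a+b+c+2*(a*b*c)) + ((a+b-c)\<^sup>2 - 4*(a*b+1))"
  define c1 where "c1 = - 2*e\<^sup>2*(a*b*c) - 2*e*((a+b+c)*(a*b*c) + 1 + 2*(a*b+a*c+b*c))
     - 2*(a+b-c) - 4*c*(a*b+1)"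
  define c2 where "c2 = (e*(a*b*c) - 1)\<^sup>2"
  have quad: "ext_quad d e = c0 + c1*d + c2*d^2 + 0*d^3 + 0*d^4" for d
    unfolding ext_quad_def ext_num_def c0_def c1_def c2_def by algebra
  have "c1 \<noteq> 0" if "c2 = 0"
  proof
    assume "c1 = 0"
    have e: "e*(a*b*c) = 1" using that unfolding c2_def by simp
    have "c1 * (a*b*c) = - 4 * (r\<^sup>2*s\<^sup>2*t\<^sup>2)"
      unfolding c1_def r s t using e by algebra
    then show False using \<open>c1 = 0\<close> rst_nonzero by auto
  qed
  then show ?thesis by (intro finite_quartic_roots[OF quad]) blast
qed

lemma finite_ext_quad_diag: "finite {d. ext_quad d d = 0}"
proof (rule finite_quartic_roots)
  show "ext_quad x x = ((a+b-c)\<^sup>2 - 4*(a*b+1)) + (- 2*(a+b+c+2*(a*b*c)) - 2*(a+b-c) - 4*c*(a*b+1))*x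
     + (1 - 2*((a+b+c)*(a*b*c) + 1 + 2*(a*b+a*c+b*c)) + 1)*x^2 + (-4*(a*b*c))*x^3 + (a*b*c)\<^sup>2*x^4" for x
    unfolding ext_quad_def ext_num_def by algebra
  show "((a+b-c)\<^sup>2 - 4*(a*b+1)) \<noteq> 0 \<or> (- 2*(a+b+c+2*(a*b*c)) - 2*(a+b-c) - 4*c*(a*b+1)) \<noteq> 0 \<or>
     (1 - 2*((a+b+c)*(a*b*c) + 1 + 2*(a*b+a*c+b*c)) + 1) \<noteq> 0 \<or> (-4*(a*b*c)) \<noteq> 0 \<or> (a*b*c)\<^sup>2 \<noteq> 0"
    using nonzero by simp
qed

definition admissible :: "rat set" where
  "admissible = {d. is_square (a*d + 1) \<and> is_square (b*d + 1) \<and> is_square (c*d + 1)}"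

text \<open>For \<open>a*b*c*d = 1\<close> the new elements have denominator 0; a vanishing product
  of the three squares makes them equal; a zero of \<open>ext_quad\<close> makes one of them 0 or an
  old element.\<close>

definition degenerate :: "rat set" where
  "degenerate = {0, a, b, c} \<union> {d. a*b*c*d = 1} \<union> {d. (a*d+1)*(b*d+1)*(c*d+1) = 0}
    \<union> {d. ext_quad d 0 = 0} \<union> {d. ext_quad d a = 0} \<union> {d. ext_quad d b = 0}
    \<union> {d. ext_quad d c = 0} \<union> {d. ext_quad d d = 0}"

lemma finite_degenerate: "finite degenerate"
proof -
  have "finite {d. k*d = m}" if "k \<noteq> 0" for k m :: rat
    by (rule finite_subset[of _ "{m / k}"]) (use that in \<open>auto simp: field_simps\<close>)
  from this[of "a*b*c" 1] this[of a "-1"] this[of b "-1"] this[of c "-1"]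
  have "finite ({d. a*b*c*d = 1} \<union> ({d. a*d = -1} \<union> {d. b*d = -1} \<union> {d. c*d = -1}))"
    using nonzero by auto
  moreover have "{d. (a*d+1)*(b*d+1)*(c*d+1) = 0} = {d. a*d = -1} \<union> {d. b*d = -1} \<union> {d. c*d = -1}"
    by (auto simp: add_eq_0_iff2)
  ultimately show ?thesis
    unfolding degenerate_def using finite_ext_quad_roots finite_ext_quad_diag by simp
qed

lemma triple_is_diophantine: "rational_diophantine_tuple 3 {a, b, c}"
proof -
  have "is_square (a*b+1)" "is_square (a*c+1)" "is_square (b*c+1)"
    by (simp_all flip: r s t)
  then show ?thesis
    using nonzero distinct unfolding rational_diophantine_tuple_def by (simp add: mult.commute)
qed

text \<open>The new elements \<open>g 1\<close> and \<open>g (-1)\<close> belong to the points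
  \<open>T + S\<close> and \<open>T - S\<close>. Their products with old elements are handled by
  \<open>ext_square\<close>; that their own product plus 1 is a square rests on the order of
  \<open>S\<close>.\<close>

lemma sextuple:
  assumes d: "d \<in> admissible" "d \<notin> degenerate"
  shows "\<exists>e f. rational_diophantine_tuple 6 {a, b, c, d, e, f}"
proof -
  obtain x y z where xyz: "x\<^sup>2 = a*d + 1" "y\<^sup>2 = b*d + 1" "z\<^sup>2 = c*d + 1"
    using d(1) unfolding admissible_def is_nth_power_def by fastforce
  define K where "K = a*b*c*d - 1"
  define N where "N = ext_num a b c d"
  define Z where "Z = r*s*t*x*y*z"
  define g where "g \<sigma> = (N + 2*\<sigma>*Z) / K\<^sup>2" for \<sigma> :: rat
  have K: "K \<noteq> 0" using d(2) unfolding degenerate_def K_def by auto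
  have "(x*y*z)\<^sup>2 = (a*d+1)*(b*d+1)*(c*d+1)" using xyz by (simp add: power_mult_distrib)
  then have "x*y*z \<noteq> 0" using d(2) unfolding degenerate_def by auto
  then have Z: "Z \<noteq> 0" using rst_nonzero unfolding Z_def by auto
  have Z2: "Z\<^sup>2 = (a*b+1)*(a*c+1)*(b*c+1)*(a*d+1)*(b*d+1)*(c*d+1)"
    unfolding Z_def power_mult_distrib xyz r s t by simp
  have quad: "ext_quad d (g \<sigma>) = 0" if "\<sigma>\<^sup>2 = 1" for \<sigma>
  proof -
    have gK: "g \<sigma> * K\<^sup>2 = N + 2*\<sigma>*Z" unfolding g_def using K by simp
    have "K\<^sup>2 * ext_quad d (g \<sigma>) = (g \<sigma> * K\<^sup>2 - N)\<^sup>2 - (N\<^sup>2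
        - K\<^sup>2 * ((a + b - c - d)\<^sup>2 - 4*(a*b+1)*(c*d+1)))"
      unfolding ext_quad_def K_def[symmetric] N_def[symmetric] by algebra
    also have "N\<^sup>2 - K\<^sup>2 * ((a + b - c - d)\<^sup>2 - 4*(a*b+1)*(c*d+1)) = 4 * Z\<^sup>2"
      using ext_prod[of a b c d] Z2 unfolding K_def N_def by simp
    also have "(g \<sigma> * K\<^sup>2 - N)\<^sup>2 - 4 * Z\<^sup>2 = 0" unfolding gK using that by algebra
    finally show ?thesis using K by simp
  qed
  have new: "g \<sigma> \<notin> {0, a, b, c, d}" if "\<sigma>\<^sup>2 = 1" for \<sigma>
    using quad[OF that] d(2) unfolding degenerate_def by auto
  have "\<exists>h. h\<^sup>2 = a * g \<sigma> + 1" "\<exists>h. h\<^sup>2 = b * g \<sigma> + 1" "\<exists>h. h\<^sup>2 = c * g \<sigma> + 1"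
    "\<exists>h. h\<^sup>2 = d * g \<sigma> + 1" if \<sigma>: "\<sigma>\<^sup>2 = 1" for \<sigma>
  proof -
    have root: "\<exists>h. h\<^sup>2 = l * g \<sigma> + 1"
      if "m\<^sup>2 = M" "M = l * (N + 2*\<sigma>*Z) + K\<^sup>2" for l m M
    proof
      show "(m / K)\<^sup>2 = l * g \<sigma> + 1"
        unfolding power_divide that g_def using K by (simp add: add_divide_distrib[of _ "K\<^sup>2"])
    qed
    \<comment> \<open>Using \<open>\<sigma>*x\<close> in place of the root \<open>x\<close> turns
      the product of the six roots into \<open>\<sigma>*Z\<close>.\<close>
    have x: "(\<sigma>*x)\<^sup>2 = d*a + 1" "(\<sigma>*x)\<^sup>2 = a*d + 1"
      using \<sigma> xyz by (simp_all add: power_mult_distrib mult.commute)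
    have r': "r\<^sup>2 = b*a + 1" and s': "s\<^sup>2 = c*a + 1" and t': "t\<^sup>2 = c*b + 1"
      and y': "y\<^sup>2 = d*b + 1" and z': "z\<^sup>2 = d*c + 1"
      using r s t xyz by (simp_all add: mult.commute)
    show "\<exists>h. h\<^sup>2 = a * g \<sigma> + 1"
      by (rule root[OF ext_square[OF r s x(2) t xyz(2,3)]])
        (unfold N_def K_def Z_def, algebra)
    show "\<exists>h. h\<^sup>2 = b * g \<sigma> + 1"
      by (rule root[OF ext_square[OF r' t xyz(2) s x(2) xyz(3)]])
        (unfold N_def K_def Z_def ext_num_swap[where a=a and b=b and c=c and d=d], algebra)
    show "\<exists>h. h\<^sup>2 = c * g \<sigma> + 1"
      by (rule root[OF ext_square[OF s' t' xyz(3) r x(2) xyz(2)]])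
        (unfold N_def K_def Z_def ext_num_swap[where a=a and b=b and c=c and d=d], algebra)
    show "\<exists>h. h\<^sup>2 = d * g \<sigma> + 1"
      by (rule root[OF ext_square[OF x(1) y' z' r s t]])
        (unfold N_def K_def Z_def ext_num_swap[where a=a and b=b and c=c and d=d], algebra)
  qed
  then have sq: "is_square (a * g \<sigma> + 1)" "is_square (b * g \<sigma> + 1)" "is_square (c * g \<sigma> + 1)"
    "is_square (d * g \<sigma> + 1)" if "\<sigma>\<^sup>2 = 1" for \<sigma>
    using that by (metis is_nth_power_nth_power)+
  have prod: "is_square (g 1 * g (-1) + 1)"
  proof -
    \<comment> \<open>By \<open>rel\<close>, \<open>q\<^sup>2\<close> equals
      \<open>(r\<^sup>2 - 1)*(s\<^sup>2 - 1)*(t\<^sup>2 - 1) + 1\<close>. It is the leading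
      coefficient of \<open>(g 1 * g (-1) + 1) * K\<^sup>2\<close> as a quadratic polynomial in
      \<open>d\<close>.\<close>
    define q where "q = r*s*t + r + s + t"
    have "q\<^sup>2 = r\<^sup>2*s\<^sup>2*t\<^sup>2 - (r\<^sup>2*s\<^sup>2 + r\<^sup>2*t\<^sup>2 + s\<^sup>2*t\<^sup>2) + (r\<^sup>2 + s\<^sup>2 + t\<^sup>2)
        + (r*s + r*t + s*t) * (r*s + r*t + s*t + 2)"
      unfolding q_def by algebra
    then have q2: "q\<^sup>2 = (a*b*c)\<^sup>2 + 1"
      unfolding rel r s t by algebra
    have "(a*b*c)\<^sup>2 + 1 > 0" by (meson add_nonneg_pos zero_le_power2 zero_less_one)
    then have q: "q \<noteq> 0" using q2 by auto
    \<comment> \<open>The discriminant of that quadratic polynomial vanishes, so it is a perfect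
      square. The inner identity is \<open>rel\<close> with the signs of the roots eliminated by
      squaring.\<close>
    have disc: "(a+b+c + 3*(a*b*c))\<^sup>2 = q\<^sup>2 * ((a+b+c)\<^sup>2 - 4*(a*b+a*c+b*c) - 3)"
    proof -
      have "(r\<^sup>2*s\<^sup>2 + r\<^sup>2*t\<^sup>2 + s\<^sup>2*t\<^sup>2)\<^sup>2 = 4*(r\<^sup>2*s\<^sup>2*t\<^sup>2)*(r\<^sup>2+s\<^sup>2+t\<^sup>2)"
      proof -
        have "r\<^sup>2*s\<^sup>2 + r\<^sup>2*t\<^sup>2 + s\<^sup>2*t\<^sup>2 = (r*s + r*t + s*t)\<^sup>2 - 2*(r*s*t)*(r+s+t)"
          "r\<^sup>2 + s\<^sup>2 + t\<^sup>2 = (r+s+t)\<^sup>2 - 2*(r*s + r*t + s*t)" by algebra+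
        then have e: "r\<^sup>2*s\<^sup>2 + r\<^sup>2*t\<^sup>2 + s\<^sup>2*t\<^sup>2 = - 2*(r*s*t)*(r+s+t)"
          "r\<^sup>2 + s\<^sup>2 + t\<^sup>2 = (r+s+t)\<^sup>2" unfolding rel by simp_all
        show ?thesis unfolding e by algebra
      qed
      then show ?thesis unfolding q2 r s t by algebra
    qed
    have "g 1 * g (-1) * K^4 = N\<^sup>2 - 4 * Z\<^sup>2"
    proof -
      have "g 1 * K\<^sup>2 = N + 2*Z" "g (-1) * K\<^sup>2 = N - 2*Z" unfolding g_def using K by simp_all
      then show ?thesis by algebra
    qed
    also have "\<dots> = K\<^sup>2 * ((a + b - c - d)\<^sup>2 - 4*(a*b+1)*(c*d+1))"
      using ext_prod[of a b c d] Z2 unfolding K_def N_def by simp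
    finally have "K\<^sup>2 * (g 1 * g (-1) * K\<^sup>2) = K\<^sup>2 * ((a + b - c - d)\<^sup>2 - 4*(a*b+1)*(c*d+1))"
      by (simp add: power_numeral_reduce algebra_simps)
    then have ef: "g 1 * g (-1) * K\<^sup>2 = (a + b - c - d)\<^sup>2 - 4*(a*b+1)*(c*d+1)" using K by simp
    have "(q * q * d - (a+b+c + 3*(a*b*c)))\<^sup>2 = q\<^sup>2 * ((g 1 * g (-1) + 1) * K\<^sup>2)"
    proof -
      have "(q * q * d - (a+b+c + 3*(a*b*c)))\<^sup>2
        = q\<^sup>2 * (q\<^sup>2 * d\<^sup>2 - 2 * d * (a+b+c + 3*(a*b*c))) + (a+b+c + 3*(a*b*c))\<^sup>2" by algebra
      also have "\<dots> = q\<^sup>2 * (q\<^sup>2 * d\<^sup>2 - 2 * d * (a+b+c + 3*(a*b*c)) + ((a+b+c)\<^sup>2 - 4*(a*b+a*c+b*c) - 3))"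
        unfolding disc by algebra
      also have "q\<^sup>2 * d\<^sup>2 - 2 * d * (a+b+c + 3*(a*b*c)) + ((a+b+c)\<^sup>2 - 4*(a*b+a*c+b*c) - 3)
        = (g 1 * g (-1) + 1) * K\<^sup>2"
        unfolding distrib_right ef unfolding q2 K_def by algebra
      finally show ?thesis .
    qed
    then have "g 1 * g (-1) + 1 = ((q * q * d - (a+b+c + 3*(a*b*c))) / (q * K))\<^sup>2"
      using q K by (simp add: power_divide power_mult_distrib)
    then show ?thesis by simp
  qed
  have "g 1 \<noteq> g (-1)" unfolding g_def using Z K by simp
  moreover have "d \<notin> {0, a, b, c}" using d(2) unfolding degenerate_def by auto
  ultimately have dist: "card {a, b, c, d, g 1, g (-1)} = 6" "0 \<notin> {a, b, c, d, g 1, g (-1)}"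
    using distinct nonzero new[of 1] new[of "-1"] by auto
  have "is_square (a*b+1)" "is_square (a*c+1)" "is_square (b*c+1)"
    "is_square (a*d+1)" "is_square (b*d+1)" "is_square (c*d+1)"
    by (simp_all flip: r s t xyz)
  then have "\<forall>x\<in>{a, b, c, d, g 1, g (-1)}. \<forall>y\<in>{a, b, c, d, g 1, g (-1)}.
      x \<noteq> y \<longrightarrow> is_square (x * y + 1)"
    using sq[of 1] sq[of "-1"] prod by (simp add: mult.commute)
  then show ?thesis using dist unfolding rational_diophantine_tuple_def by blast
qed

text \<open>Finitely many sets \<open>{d, e, f}\<close> would have a finite union, yet the union
  contains every admissible nondegenerate \<open>d\<close>.\<close>

lemma infinite_sextuples:
  assumes "infinite admissible"
  shows "infinite {{d, e, f} | d e f. rational_diophantine_tuple 6 {a, b, c, d, e, f}}"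
    (is "infinite ?S")
proof
  assume "finite ?S"
  moreover have "finite A" if "A \<in> ?S" for A using that by auto
  ultimately have "finite (\<Union> ?S)" by auto
  moreover have "admissible - degenerate \<subseteq> \<Union> ?S"
  proof
    fix d assume "d \<in> admissible - degenerate"
    then obtain e f where "rational_diophantine_tuple 6 {a, b, c, d, e, f}"
      using sextuple by blast
    then have "{d, e, f} \<in> ?S" by blast
    then show "d \<in> \<Union> ?S" by blast
  qed
  ultimately have "finite (admissible - degenerate)" by (rule finite_subset[rotated])
  then show False using assms finite_degenerate by simp
qed

end


section \<open>Infinitely many extensions from a 2-adically small point\<close>

text \<open>
  The numbers \<open>g\<^sub>1\<close>, \<open>g\<^sub>2\<close>, \<open>g\<^sub>3\<close> are the square roots of \<open>x(Q) + bc\<close>, \<open>x(Q) + ac\<close>, \<open>x(Q) + ab\<close>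
  for a point \<open>Q \<in> 2E(\<rat>)\<close>. Equality of their 2-adic valuations is what makes \<open>Q\<close> a point of
  infinite order.
\<close>

definition admissible_seed :: "rat \<Rightarrow> rat \<Rightarrow> rat \<Rightarrow> bool" where
  "admissible_seed a b c \<longleftrightarrow> (\<exists>k g\<^sub>1 g\<^sub>2 g\<^sub>3. has_val k g\<^sub>1 \<and> has_val k g\<^sub>2 \<and> has_val k g\<^sub>3 \<and>
     g\<^sub>1\<^sup>2 - b*c = g\<^sub>2\<^sup>2 - a*c \<and> g\<^sub>2\<^sup>2 - a*c = g\<^sub>3\<^sup>2 - a*b)"

lemma admissible_seedI:
  assumes "has_val k g\<^sub>1" "has_val k g\<^sub>2" "has_val k g\<^sub>3"
    and "g\<^sub>1\<^sup>2 - g\<^sub>2\<^sup>2 = c*(b - a)" "g\<^sub>2\<^sup>2 - g\<^sub>3\<^sup>2 = a*(c - b)"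
  shows "admissible_seed a b c"
proof -
  have "g\<^sub>1\<^sup>2 - b*c = g\<^sub>2\<^sup>2 - a*c" "g\<^sub>2\<^sup>2 - a*c = g\<^sub>3\<^sup>2 - a*b"
    using assms(4,5) by (simp_all add: algebra_simps)
  then show ?thesis using assms(1-3) unfolding admissible_seed_def by blast
qed

lemma admissible_seed_commute: "admissible_seed b a c \<Longrightarrow> admissible_seed a b c"
  unfolding admissible_seed_def by (metis mult.commute)

text \<open>This is the duplication formula in terms of the roots: the new ones are
  \<open>(B + C - A)/E\<close> and its analogues, with \<open>E\<close> twice the ordinate. The
  numerators have valuation \<open>4*k\<close> and \<open>E\<close> has
  \<open>3*k + 1\<close>.\<close>

lemma double_point:
  fixes g\<^sub>1 g\<^sub>2 g\<^sub>3 :: rat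
  assumes "has_val k g\<^sub>1" "has_val k g\<^sub>2" "has_val k g\<^sub>3"
  obtains h\<^sub>1 h\<^sub>2 h\<^sub>3 where "has_val (k - 1) h\<^sub>1" "has_val (k - 1) h\<^sub>2" "has_val (k - 1) h\<^sub>3"
    "h\<^sub>1\<^sup>2 - h\<^sub>2\<^sup>2 = g\<^sub>1\<^sup>2 - g\<^sub>2\<^sup>2" "h\<^sub>2\<^sup>2 - h\<^sub>3\<^sup>2 = g\<^sub>2\<^sup>2 - g\<^sub>3\<^sup>2"
proof -
  define A B C where "A = (g\<^sub>2*g\<^sub>3)\<^sup>2" and "B = (g\<^sub>1*g\<^sub>3)\<^sup>2" and "C = (g\<^sub>1*g\<^sub>2)\<^sup>2"
  define E where "E = 2*(g\<^sub>1*g\<^sub>2*g\<^sub>3)"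
  have v: "has_val (4*k) A" "has_val (4*k) B" "has_val (4*k) C"
    using has_val_power2[OF has_val_mult] assms unfolding A_def B_def C_def by fastforce+
  then have "has_val (4*k) (A + B + C)"
    using has_val_add[OF v(3) has_val_add_same[OF v(1,2)]] by (simp add: add.commute)
  note S = has_val_signed_sums[OF v[THEN has_val_imp_ge] this]
  have E: "has_val (1 + (k + k + k)) E"
    unfolding E_def using assms by (intro has_val_mult has_val_two)
  have nz: "g\<^sub>1 \<noteq> 0" "g\<^sub>2 \<noteq> 0" "g\<^sub>3 \<noteq> 0" using assms has_val_nonzero by auto
  have *: "4*k - (1 + (k + k + k)) = k - 1" by simp
  note S' = S[THEN has_val_divide, OF E, unfolded *]
  have "((B + C - A)/E)\<^sup>2 - ((A + C - B)/E)\<^sup>2 = g\<^sub>1\<^sup>2 - g\<^sub>2\<^sup>2"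
  proof -
    have "(B + C - A)\<^sup>2 - (A + C - B)\<^sup>2 = (g\<^sub>1\<^sup>2 - g\<^sub>2\<^sup>2) * E\<^sup>2"
      unfolding A_def B_def C_def E_def by algebra
    then show ?thesis using nz by (simp add: power_divide E_def flip: diff_divide_distrib)
  qed
  moreover have "((A + C - B)/E)\<^sup>2 - ((A + B - C)/E)\<^sup>2 = g\<^sub>2\<^sup>2 - g\<^sub>3\<^sup>2"
  proof -
    have "(A + C - B)\<^sup>2 - (A + B - C)\<^sup>2 = (g\<^sub>2\<^sup>2 - g\<^sub>3\<^sup>2) * E\<^sup>2"
      unfolding A_def B_def C_def E_def by algebra
    then show ?thesis using nz by (simp add: power_divide E_def flip: diff_divide_distrib)
  qed
  ultimately show ?thesis using that S' by blast
qed

text \<open>Repeated doubling lowers the common valuation by 1 each time, so the abscissae are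
  distinct.\<close>

lemma infinite_seed_points:
  assumes "admissible_seed a b c"
  shows "infinite {x. \<exists>g\<^sub>1 g\<^sub>2 g\<^sub>3. g\<^sub>1 \<noteq> 0 \<and> g\<^sub>2 \<noteq> 0 \<and> g\<^sub>3 \<noteq> 0 \<and>
     g\<^sub>1\<^sup>2 = x + b*c \<and> g\<^sub>2\<^sup>2 = x + a*c \<and> g\<^sub>3\<^sup>2 = x + a*b}" (is "infinite ?X")
proof -
  obtain k g\<^sub>1 g\<^sub>2 g\<^sub>3 where g: "has_val k g\<^sub>1" "has_val k g\<^sub>2" "has_val k g\<^sub>3"
    "g\<^sub>1\<^sup>2 - g\<^sub>2\<^sup>2 = b*c - a*c" "g\<^sub>2\<^sup>2 - g\<^sub>3\<^sup>2 = a*c - a*b"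
    using assms unfolding admissible_seed_def by (auto simp: algebra_simps)
  have "\<exists>g\<^sub>1 g\<^sub>2 g\<^sub>3. has_val (k - int n) g\<^sub>1 \<and> has_val (k - int n) g\<^sub>2 \<and> has_val (k - int n) g\<^sub>3 \<and>
    g\<^sub>1\<^sup>2 - g\<^sub>2\<^sup>2 = b*c - a*c \<and> g\<^sub>2\<^sup>2 - g\<^sub>3\<^sup>2 = a*c - a*b" for n
  proof (induction n)
    case 0
    then show ?case using g by auto
  next
    case (Suc n)
    then obtain g\<^sub>1 g\<^sub>2 g\<^sub>3 where g: "has_val (k - int n) g\<^sub>1" "has_val (k - int n) g\<^sub>2"
      "has_val (k - int n) g\<^sub>3" "g\<^sub>1\<^sup>2 - g\<^sub>2\<^sup>2 = b*c - a*c" "g\<^sub>2\<^sup>2 - g\<^sub>3\<^sup>2 = a*c - a*b"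
      by blast
    have "k - int (Suc n) = k - int n - 1" by simp
    with double_point[OF g(1-3)] g(4,5) show ?case by metis
  qed
  then obtain G\<^sub>1 G\<^sub>2 G\<^sub>3 where G: "\<And>n. has_val (k - int n) (G\<^sub>1 n)" "\<And>n. has_val (k - int n) (G\<^sub>2 n)"
    "\<And>n. has_val (k - int n) (G\<^sub>3 n)" "\<And>n. (G\<^sub>1 n)\<^sup>2 - (G\<^sub>2 n)\<^sup>2 = b*c - a*c"
    "\<And>n. (G\<^sub>2 n)\<^sup>2 - (G\<^sub>3 n)\<^sup>2 = a*c - a*b"
    by metis
  define x where "x n = (G\<^sub>1 n)\<^sup>2 - b*c" for n
  have "inj x"
  proof (rule injI)
    fix m n assume "x m = x n"
    then have "(G\<^sub>1 m)\<^sup>2 = (G\<^sub>1 n)\<^sup>2" unfolding x_def by simp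
    then have "2 * (k - int m) = 2 * (k - int n)"
      using has_val_power2[OF G(1)] by (metis has_val_unique)
    then show "m = n" by simp
  qed
  moreover have "range x \<subseteq> ?X"
  proof
    fix y assume "y \<in> range x"
    then obtain n where n: "y = x n" by blast
    have "(G\<^sub>1 n)\<^sup>2 = y + b*c" "(G\<^sub>2 n)\<^sup>2 = y + a*c" "(G\<^sub>3 n)\<^sup>2 = y + a*b"
      using G(4,5)[of n] unfolding n x_def by auto
    then show "y \<in> ?X" using G(1-3)[of n, THEN has_val_nonzero] by blast
  qed
  ultimately show ?thesis by (meson finite_imageD finite_subset infinite_UNIV_nat)
qed

text \<open>\<open>l\<close> is the slope of the chord through \<open>P\<close> and
  \<open>(x, y)\<close>, and \<open>a*b*c*d\<close> is the abscissa of its third intersection with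
  the curve. Evaluating cubic minus squared line at \<open>-(b*c)\<close> gives the claim.\<close>

lemma chord_square:
  fixes a b c d x l :: rat
  assumes "x \<noteq> 0" "b*c \<noteq> 0" "l*x = y - a*b*c" "a*b*c*d = l\<^sup>2 - (a*b + a*c + b*c) - x"
    and "y\<^sup>2 = (x + a*b)*(x + a*c)*(x + b*c)"
  shows "(a*d + 1)*(x + b*c) = (a - l)\<^sup>2"
proof -
  have "x*(b*c)*((a*d + 1)*(x + b*c)) = x*((a*b*c*d + b*c)*(x + b*c))" by algebra
  also have "\<dots> = (l*x)\<^sup>2 + x*(l\<^sup>2*(b*c)) - x*(x + a*b + a*c)*(x + b*c)"
    unfolding assms(4) by algebra
  also have "(l*x)\<^sup>2 = y\<^sup>2 - (a*b*c)\<^sup>2 - 2*(a*b*c)*(l*x)" unfolding assms(3) by algebra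
  also have "y\<^sup>2 - (a*b*c)\<^sup>2 - 2*(a*b*c)*(l*x) + x*(l\<^sup>2*(b*c)) - x*(x + a*b + a*c)*(x + b*c)
    = x*(b*c)*(a - l)\<^sup>2" unfolding assms(5) by algebra
  finally show ?thesis using assms(1,2) by simp
qed

lemma infinite_admissible:
  fixes a b c :: rat
  assumes "admissible_seed a b c" and nz: "a \<noteq> 0" "b \<noteq> 0" "c \<noteq> 0"
  shows "infinite {d. is_square (a*d + 1) \<and> is_square (b*d + 1) \<and> is_square (c*d + 1)}"
    (is "infinite ?D")
proof
  assume fin: "finite ?D"
  define X where "X = {x. \<exists>g\<^sub>1 g\<^sub>2 g\<^sub>3. g\<^sub>1 \<noteq> 0 \<and> g\<^sub>2 \<noteq> 0 \<and> g\<^sub>3 \<noteq> 0 \<and>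
     g\<^sub>1\<^sup>2 = x + b*c \<and> g\<^sub>2\<^sup>2 = x + a*c \<and> g\<^sub>3\<^sup>2 = x + a*b}"
  \<comment> \<open>A relation between \<open>d\<close> and \<open>x\<close> with the ordinate
    eliminated. For fixed \<open>d\<close> it has finitely many solutions \<open>x\<close>, so
    infinitely many points yield infinitely many \<open>d\<close>.\<close>
  define P where "P d x = 4*((x + a*b)*(x + a*c)*(x + b*c))
     - ((a+b+c)*x + 2*(a*b*c) - d*x\<^sup>2)\<^sup>2" for d x
  have "\<exists>d\<in>?D. P d x = 0" if X: "x \<in> X - {0}" for x
  proof -
    have x: "x \<noteq> 0" using X by simp
    obtain g\<^sub>1 g\<^sub>2 g\<^sub>3 where g0: "g\<^sub>1 \<noteq> 0" "g\<^sub>2 \<noteq> 0" "g\<^sub>3 \<noteq> 0"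
      and g: "g\<^sub>1\<^sup>2 = x + b*c" "g\<^sub>2\<^sup>2 = x + a*c" "g\<^sub>3\<^sup>2 = x + a*b"
      using X unfolding X_def by blast
    define y where "y = g\<^sub>1*g\<^sub>2*g\<^sub>3"
    have y: "y\<^sup>2 = (x + a*b)*(x + a*c)*(x + b*c)"
      unfolding y_def power_mult_distrib g by simp
    define l where "l = (y - a*b*c) / x"
    have l: "l*x = y - a*b*c" unfolding l_def using x by simp
    define d where "d = (l\<^sup>2 - (a*b + a*c + b*c) - x) / (a*b*c)"
    have d: "a*b*c*d = l\<^sup>2 - (a*b + a*c + b*c) - x" unfolding d_def using nz by simp
    have "(a*d + 1) * g\<^sub>1\<^sup>2 = (a - l)\<^sup>2" unfolding g
      by (rule chord_square[OF x _ l d y]) (use nz in auto)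
    moreover have "(b*d + 1) * g\<^sub>2\<^sup>2 = (b - l)\<^sup>2" unfolding g
      by (rule chord_square[where y = y]) (use x nz l d y in \<open>auto simp: ac_simps\<close>)
    moreover have "(c*d + 1) * g\<^sub>3\<^sup>2 = (c - l)\<^sup>2" unfolding g
      by (rule chord_square[where y = y]) (use x nz l d y in \<open>auto simp: ac_simps\<close>)
    ultimately have "a*d + 1 = ((a - l) / g\<^sub>1)\<^sup>2" "b*d + 1 = ((b - l) / g\<^sub>2)\<^sup>2"
      "c*d + 1 = ((c - l) / g\<^sub>3)\<^sup>2"
      using g0 by (simp_all add: power_divide eq_divide_eq)
    then have "d \<in> ?D" by simp
    moreover have "P d x = 0"
    proof -
      have "(a*b*c)*(d*x\<^sup>2) = (a*b*c*d)*x\<^sup>2" by algebra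
      also have "\<dots> = (l*x)\<^sup>2 - (a*b + a*c + b*c)*x\<^sup>2 - x^3" unfolding d by algebra
      also have "\<dots> = y\<^sup>2 - 2*(a*b*c)*y + (a*b*c)\<^sup>2 - (a*b + a*c + b*c)*x\<^sup>2 - x^3"
        unfolding l by algebra
      also have "\<dots> = (a*b*c)*((a+b+c)*x + 2*(a*b*c) - 2*y)" unfolding y by algebra
      finally have "d*x\<^sup>2 = (a+b+c)*x + 2*(a*b*c) - 2*y" using nz by simp
      then have "P d x = 4*y\<^sup>2 - (2*y)\<^sup>2" unfolding P_def y by simp
      then show ?thesis by simp
    qed
    ultimately show ?thesis by blast
  qed
  then have "X - {0} \<subseteq> (\<Union>d\<in>?D. {x. P d x = 0})" by blast
  moreover have "finite {x. P d x = 0}" for d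
  proof (rule finite_quartic_roots)
    show "P d x = 0 + 0*x + (4*(a*b+a*c+b*c) - (a+b+c)\<^sup>2 + 4*d*(a*b*c))*x^2
      + (4 + 2*d*(a+b+c))*x^3 + (- d\<^sup>2)*x^4" for x
      unfolding P_def by algebra
  \<comment> \<open>If the coefficient \<open>- d\<^sup>2\<close> vanishes, the cubic coefficient is
    4.\<close>
  qed auto
  ultimately have "finite (X - {0})" using fin finite_subset by blast
  then show False using infinite_seed_points[OF assms(1)] unfolding X_def by simp
qed


section \<open>Existence of a 2-adically small point\<close>

text \<open>The seed \<open>2P\<close>.\<close>

lemma seed_double_zero:
  assumes "val_ge k a" "val_ge k b" "val_ge k c" "has_val k (a + b + c)"
  shows "admissible_seed a b c"
proof (rule admissible_seedI)
  \<comment> \<open>The witnesses come from the duplication formula at the point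
    \<open>(0, a*b*c)\<close>.\<close>
  note S = has_val_signed_sums[OF assms]
  show "has_val (k - 1) ((b + c - a)/2)" "has_val (k - 1) ((a + c - b)/2)"
    "has_val (k - 1) ((a + b - c)/2)"
    using S[THEN has_val_divide, OF has_val_two] .
qed (simp_all add: power2_eq_square field_simps)

text \<open>The seed \<open>2T\<close>, where \<open>x(T) = abcd\<close>.\<close>

lemma seed_double:
  assumes x: "x\<^sup>2 = a*d + 1" and y: "y\<^sup>2 = b*d + 1" and z: "z\<^sup>2 = c*d + 1"
    and nz: "x \<noteq> 0" "y \<noteq> 0" "z \<noteq> 0"
    and val: "val_ge k (a*(y\<^sup>2*z\<^sup>2))" "val_ge k (b*(x\<^sup>2*z\<^sup>2))" "val_ge k (c*(x\<^sup>2*y\<^sup>2))"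
      "has_val k (a*(y\<^sup>2*z\<^sup>2) + b*(x\<^sup>2*z\<^sup>2) + c*(x\<^sup>2*y\<^sup>2))"
  shows "admissible_seed a b c"
proof -
  \<comment> \<open>The duplication formula at abscissa \<open>a*b*c*d\<close>, with a factor
    \<open>a*b*c\<close> cancelled.\<close>
  define A B C E where "A = a*(y\<^sup>2*z\<^sup>2)" and "B = b*(x\<^sup>2*z\<^sup>2)" and "C = c*(x\<^sup>2*y\<^sup>2)" and "E = 2*(x*y*z)"
  have E: "E \<noteq> 0" unfolding E_def using nz by simp
  then obtain m where m: "has_val m E" by (rule has_val_exists)
  show ?thesis
  proof (rule admissible_seedI)
    note S = has_val_signed_sums[OF val, folded A_def B_def C_def]
    show "has_val (k - m) ((B + C - A)/E)" "has_val (k - m) ((A + C - B)/E)"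
      "has_val (k - m) ((A + B - C)/E)"
      using S[THEN has_val_divide, OF m] .
    have ba: "b*x\<^sup>2 - a*y\<^sup>2 = b - a" and cb: "c*y\<^sup>2 - b*z\<^sup>2 = c - b" unfolding x y z by algebra+
    have "(B + C - A)\<^sup>2 - (A + C - B)\<^sup>2 = c*(b*x\<^sup>2 - a*y\<^sup>2) * E\<^sup>2"
      unfolding A_def B_def C_def E_def by algebra
    then show "((B + C - A)/E)\<^sup>2 - ((A + C - B)/E)\<^sup>2 = c*(b - a)"
      unfolding ba using E by (simp add: power_divide flip: diff_divide_distrib)
    have "(A + C - B)\<^sup>2 - (A + B - C)\<^sup>2 = a*(c*y\<^sup>2 - b*z\<^sup>2) * E\<^sup>2"
      unfolding A_def B_def C_def E_def by algebra
    then show "((A + C - B)/E)\<^sup>2 - ((A + B - C)/E)\<^sup>2 = a*(c - b)"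
      unfolding cb using E by (simp add: power_divide flip: diff_divide_distrib)
  qed
qed

text \<open>A common denominator shifts all three valuations equally, so comparing numerators
  suffices.\<close>

lemma seed_three_same:
  assumes "n\<^sub>1\<^sup>2 - n\<^sub>2\<^sup>2 = c*(b - a)*e\<^sup>2" "n\<^sub>2\<^sup>2 - n\<^sub>3\<^sup>2 = a*(c - b)*e\<^sup>2" "e \<noteq> 0"
    and "has_val k n\<^sub>1" "has_val k n\<^sub>2" "has_val k n\<^sub>3"
  shows "admissible_seed a b c"
proof -
  obtain m where m: "has_val m e" using assms(3) by (rule has_val_exists)
  show ?thesis
  proof (rule admissible_seedI)
    show "has_val (k - m) (n\<^sub>1/e)" "has_val (k - m) (n\<^sub>2/e)" "has_val (k - m) (n\<^sub>3/e)"
      using assms(4-6)[THEN has_val_divide, OF m] .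
  qed (use assms(1-3) in \<open>simp_all add: power_divide flip: diff_divide_distrib\<close>)
qed

context order3_triple
begin

text \<open>Otherwise \<open>rel\<close> would equate a sum of three odd terms with 0.\<close>

lemma not_all_units: "\<not> (has_val 0 r \<and> has_val 0 s \<and> has_val 0 t)"
proof
  assume "has_val 0 r \<and> has_val 0 s \<and> has_val 0 t"
  then have "has_val 0 (r*s)" "has_val 0 (r*t)" "has_val 0 (s*t)"
    using has_val_mult[of 0 _ 0] by auto
  from has_val_add_three[OF this] show False using rel has_val_nonzero by blast
qed

text \<open>A tie between \<open>a\<close> and \<open>b\<close> forces \<open>k \<le> -2\<close>.
  The seed is \<open>2A\<close> if \<open>k + l \<le> 0\<close> and \<open>A - B\<close>
  otherwise.\<close>

lemma seed_ab_minimal: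
  assumes w: "w\<^sup>2 = a\<^sup>2 + 1" and w': "w'\<^sup>2 = b\<^sup>2 + 1"
    and a: "has_val k a" and b: "has_val k b" and c: "has_val l c" and kl: "k < l"
  shows "admissible_seed a b c"
proof -
  have ab: "has_val (2*k) (a*b)" and ac: "has_val (k + l) (a*c)" and bc: "has_val (k + l) (b*c)"
    using has_val_mult[OF a b] has_val_mult[OF a c] has_val_mult[OF b c] by simp_all
  have k: "k \<le> -2"
  proof (rule ccontr)
    assume "\<not> k \<le> -2"
    then have "k \<ge> 2" using val_of_strong[OF w a] by simp
    then have "has_val 0 r" "has_val 0 s" "has_val 0 t"
      using has_val_sqrt_pos[OF r has_val_imp_ge[OF ab]] has_val_sqrt_pos[OF s has_val_imp_ge[OF ac]]
        has_val_sqrt_pos[OF t has_val_imp_ge[OF bc]] kl by simp_all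
    then show False using not_all_units by blast
  qed
  have rk: "has_val k r" using has_val_sqrt_neg[OF r ab] k by simp
  have wk: "has_val k w" using has_val_sqrt_neg[OF w has_val_power2[OF a]] k by simp
  have nz: "w \<noteq> 0" "r \<noteq> 0" "s \<noteq> 0" using rst_nonzero has_val_nonzero[OF wk] by auto
  have w_eq: "w\<^sup>2 = a*a + 1" and r_eq: "r\<^sup>2 = b*a + 1" and s_eq: "s\<^sup>2 = c*a + 1"
    using w r s by (simp_all add: power2_eq_square mult.commute)
  \<comment> \<open>Taking \<open>d = a\<close> gives the abscissa of \<open>A\<close>, and the
    three roots are then \<open>w\<close>, \<open>r\<close>, \<open>s\<close>.\<close>
  note double = seed_double[OF w_eq r_eq s_eq nz]
  note w2 = has_val_power2[OF wk] and r2 = has_val_power2[OF rk]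
  have cwr: "has_val (l + (2*k + 2*k)) (c*(w\<^sup>2*r\<^sup>2))"
    by (intro has_val_mult c w2 r2)
  consider "k + l < 0" | "k + l = 0" | "k + l > 0" by linarith
  then show ?thesis
  proof cases
    case 1
    have s2: "has_val (k + l) (s\<^sup>2)"
      unfolding s using ac 1 by (intro has_val_add[OF _ has_val_imp_ge[OF has_val_one]]) auto
    have "has_val (k + (2*k + (k + l))) (a*(r\<^sup>2*s\<^sup>2))" "has_val (k + (2*k + (k + l))) (b*(w\<^sup>2*s\<^sup>2))"
      by (intro has_val_mult a b r2 w2 s2)+
    moreover have "k + (2*k + (k + l)) = l + (2*k + 2*k)" by simp
    ultimately have "has_val (l + (2*k + 2*k)) (a*(r\<^sup>2*s\<^sup>2))" "has_val (l + (2*k + 2*k)) (b*(w\<^sup>2*s\<^sup>2))"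
      by metis+
    then show ?thesis
      using double has_val_add_three[OF _ _ cwr] has_val_imp_ge cwr by blast
  next
    case 2
    have s2: "val_ge 1 (s\<^sup>2)"
      unfolding s using has_val_add_same[OF ac[unfolded 2] has_val_one] by simp
    have "val_ge (k + (2*k + 1)) (a*(r\<^sup>2*s\<^sup>2))" "val_ge (k + (2*k + 1)) (b*(w\<^sup>2*s\<^sup>2))"
      by (intro val_ge_mult s2 has_val_imp_ge a b r2 w2)+
    moreover have "l + (2*k + 2*k) < k + (2*k + 1)" using 2 by simp
    ultimately have "val_ge (l + (2*k + 2*k)) (a*(r\<^sup>2*s\<^sup>2))" "val_ge (l + (2*k + 2*k)) (b*(w\<^sup>2*s\<^sup>2))"
      "has_val (l + (2*k + 2*k)) (c*(w\<^sup>2*r\<^sup>2) + (a*(r\<^sup>2*s\<^sup>2) + b*(w\<^sup>2*s\<^sup>2)))"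
      using has_val_add[OF cwr val_ge_add] by (auto intro: val_ge_mono)
    then show ?thesis
      using double has_val_imp_ge[OF cwr] by (simp add: ac_simps)
  next
    case 3
    have s0: "has_val 0 s" and t0: "has_val 0 t"
      using has_val_sqrt_pos[OF s has_val_imp_ge[OF ac] 3] has_val_sqrt_pos[OF t has_val_imp_ge[OF bc] 3]
      by simp_all
    obtain x where x: "x\<^sup>2 = a\<^sup>2 + 1" "has_val k x" "has_val (- (k + 1)) (x - a)"
      using sqrt_near_large[OF w a] k by auto
    obtain y where y: "y\<^sup>2 = b\<^sup>2 + 1" "has_val k y" "has_val (- (k + 1)) (y - b)"
      using sqrt_near_large[OF w' b] k by auto
    \<comment> \<open>By \<open>rel\<close> the sum \<open>s + t\<close> has valuation
      \<open>- k\<close>, at least 2, so \<open>t - s\<close> is close to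
      \<open>- (2*s)\<close>.\<close>
    have st: "has_val 1 (t - s)"
    proof -
      have "r*(s + t) = - (s*t)" using rel by algebra
      then have "s + t = - (s*t) / r" using nz by (metis nonzero_mult_div_cancel_left)
      then have "has_val (0 + 0 - k) (s + t)"
        by (simp only:) (intro has_val_divide has_val_minus has_val_mult s0 t0 rk)
      then have "val_ge 2 (s + t)" using k by (auto intro: has_val_ge)
      moreover have "has_val 1 (- (2*s))"
        using has_val_minus[OF has_val_mult[OF has_val_two s0]] by simp
      ultimately have "has_val 1 (- (2*s) + (s + t))" by (intro has_val_add) auto
      then show ?thesis by (simp add: algebra_simps)
    qed
    have xy: "val_ge (-1) (x*y - a*b)"
    proof -
      have "val_ge (k + - (k + 1)) (a*(y - b))" "val_ge (k + - (k + 1)) (y*(x - a))"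
        by (intro val_ge_mult has_val_imp_ge a x y)+
      then have "val_ge (-1) (a*(y - b) + y*(x - a))" by (intro val_ge_add) auto
      then show ?thesis by (simp add: algebra_simps)
    qed
    \<comment> \<open>\<open>r\<close> and \<open>a\<close> have equal valuation, so
      \<open>r\<^sup>2 - a\<^sup>2\<close> gains a factor 8 over \<open>a\<^sup>2\<close>; it equals
      \<open>a*(b - a) + 1\<close>.\<close>
    have diff: "val_ge (k + 3) (b - a)"
    proof -
      have "has_val 0 (r/a)" using has_val_divide[OF rk a] by simp
      then have "val_ge (2*k + 3) (a\<^sup>2*((r/a)\<^sup>2 - 1))"
        by (intro val_ge_mult odd_square_minus_one has_val_imp_ge has_val_power2 a)
      moreover have "a\<^sup>2*((r/a)\<^sup>2 - 1) - 1 = a*(b - a)"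
        using nonzero r by (simp add: power_divide right_diff_distrib power2_eq_square)
      moreover have "val_ge (2*k + 3) 1"
        using has_val_ge[OF has_val_one, of "2*k + 3"] k by simp
      ultimately have "val_ge (2*k + 3) (a*(b - a))" using val_ge_diff by metis
      then have "val_ge (- k + (2*k + 3)) (1/a*(a*(b - a)))"
        by (rule val_ge_mult[OF has_val_imp_ge[OF has_val_inverse[OF a]]])
      then show ?thesis using nonzero by (simp add: add.commute)
    qed
    \<comment> \<open>the seed \<open>A - B\<close>, with the signs of \<open>x\<close> and \<open>y\<close> chosen so that \<open>x\<close> is close to \<open>a\<close> and \<open>y\<close> to \<open>b\<close>\<close>
    show ?thesis
    proof (rule seed_three_same)
      show "(x*y*t - r\<^sup>2*s)\<^sup>2 - (r\<^sup>2*t - x*y*s)\<^sup>2 = c*(b - a)*(a - b)\<^sup>2"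
      proof -
        have "(x*y*t - r\<^sup>2*s)\<^sup>2 - (r\<^sup>2*t - x*y*s)\<^sup>2 = (t\<^sup>2 - s\<^sup>2)*(x\<^sup>2*y\<^sup>2 - (r\<^sup>2)\<^sup>2)" by algebra
        then show ?thesis unfolding x y r s t by algebra
      qed
      show "(r\<^sup>2*t - x*y*s)\<^sup>2 - (r*(s*y - t*x))\<^sup>2 = a*(c - b)*(a - b)\<^sup>2"
      proof -
        have "(r\<^sup>2*t - x*y*s)\<^sup>2 - (r*(s*y - t*x))\<^sup>2 = (x\<^sup>2 - r\<^sup>2)*(y\<^sup>2*s\<^sup>2 - r\<^sup>2*t\<^sup>2)" by algebra
        then show ?thesis unfolding x y r s t by algebra
      qed
      show "a - b \<noteq> 0" using distinct by simp
      \<comment> \<open>Replacing \<open>x*y\<close> and \<open>r\<^sup>2\<close> by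
        \<open>a*b\<close> turns the first two numerators into \<open>a*b*(t - s)\<close>; the
        errors have valuation at least -1, above \<open>2*k + 1\<close>.\<close>
      have main: "has_val (2*k + 1) (a*b*(t - s))" by (intro has_val_mult ab st)
      have err: "val_ge (-1 + 0) ((x*y - a*b)*t)" "val_ge (-1 + 0) ((x*y - a*b)*s)"
        by (intro val_ge_mult xy has_val_imp_ge s0 t0)+
      then have "has_val (2*k + 1) (a*b*(t - s) + ((x*y - a*b)*t - s))"
        using k has_val_ge[OF s0, of "-1"] by (intro has_val_add[OF main val_ge_diff]) auto
      moreover have "a*b*(t - s) + ((x*y - a*b)*t - s) = x*y*t - r\<^sup>2*s" unfolding r by algebra
      ultimately show "has_val (2*k + 1) (x*y*t - r\<^sup>2*s)" by simp
      have "has_val (2*k + 1) (a*b*(t - s) + (t - (x*y - a*b)*s))"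
        using k err has_val_ge[OF t0, of "-1"] by (intro has_val_add[OF main val_ge_diff]) auto
      moreover have "a*b*(t - s) + (t - (x*y - a*b)*s) = r\<^sup>2*t - x*y*s" unfolding r by algebra
      ultimately show "has_val (2*k + 1) (r\<^sup>2*t - x*y*s)" by simp
      \<comment> \<open>In the third numerator \<open>x\<close> and \<open>y\<close> are both
        replaced by \<open>b\<close>. The errors have valuation at least \<open>k + 2\<close>, since
        \<open>k \<le> -2\<close> gives \<open>- (k + 1) \<ge> k + 2\<close>.\<close>
      have "has_val (k + 1) (b*(t - s))" by (intro has_val_mult b st)
      moreover have "val_ge (0 + (k + 3)) (t*(a - b))"
        using val_ge_minus[OF diff] by (intro val_ge_mult has_val_imp_ge[OF t0]) simp
      moreover have "val_ge (0 + - (k + 1)) (s*(y - b))" "val_ge (0 + - (k + 1)) (t*(x - a))"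
        by (intro val_ge_mult has_val_imp_ge s0 t0 x y)+
      ultimately have "has_val (k + 1) (- (b*(t - s)) + ((s*(y - b) - t*(x - a)) - t*(a - b)))"
        using k by (intro has_val_add[where l = "k + 2"] has_val_minus val_ge_diff)
          (auto elim: val_ge_mono)
      moreover have "- (b*(t - s)) + ((s*(y - b) - t*(x - a)) - t*(a - b)) = s*y - t*x" by algebra
      ultimately have "has_val (k + 1) (s*y - t*x)" by simp
      from has_val_mult[OF rk this] show "has_val (2*k + 1) (r*(s*y - t*x))" by simp
    qed
  qed
qed

text \<open>In a tie between \<open>a\<close> and \<open>c\<close> the seed is again
  \<open>2A\<close> if \<open>k + l \<le> 0\<close>; otherwise \<open>b\<close> is 2-adically small
  and \<open>P - B\<close> serves.\<close>

lemma seed_ac_minimal: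
  assumes w: "w\<^sup>2 = a\<^sup>2 + 1" and w': "w'\<^sup>2 = b\<^sup>2 + 1"
    and a: "has_val k a" and b: "has_val l b" and c: "has_val k c" and kl: "k < l"
  shows "admissible_seed a b c"
proof -
  have ac: "has_val (2*k) (a*c)" and ab: "has_val (k + l) (a*b)" and bc: "has_val (k + l) (b*c)"
    using has_val_mult[OF a c] has_val_mult[OF a b] has_val_mult[OF b c] by (simp_all add: add.commute)
  have k: "k \<le> -2"
  proof (rule ccontr)
    assume "\<not> k \<le> -2"
    then have "k \<ge> 2" using val_of_strong[OF w a] by simp
    then have "has_val 0 r" "has_val 0 s" "has_val 0 t"
      using has_val_sqrt_pos[OF r has_val_imp_ge[OF ab]] has_val_sqrt_pos[OF s has_val_imp_ge[OF ac]]
        has_val_sqrt_pos[OF t has_val_imp_ge[OF bc]] kl by simp_all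
    then show False using not_all_units by blast
  qed
  have sk: "has_val k s" using has_val_sqrt_neg[OF s ac] k by simp
  have wk: "has_val k w" using has_val_sqrt_neg[OF w has_val_power2[OF a]] k by simp
  have nz: "w \<noteq> 0" "r \<noteq> 0" "s \<noteq> 0" using rst_nonzero has_val_nonzero[OF wk] by auto
  have w_eq: "w\<^sup>2 = a*a + 1" and r_eq: "r\<^sup>2 = b*a + 1" and s_eq: "s\<^sup>2 = c*a + 1"
    using w r s by (simp_all add: power2_eq_square mult.commute)
  note double = seed_double[OF w_eq r_eq s_eq nz]
  note w2 = has_val_power2[OF wk] and s2 = has_val_power2[OF sk]
  have bws: "has_val (l + (2*k + 2*k)) (b*(w\<^sup>2*s\<^sup>2))"
    by (intro has_val_mult b w2 s2)
  consider "k + l < 0" | "k + l = 0" | "k + l > 0" by linarith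
  then show ?thesis
  proof cases
    case 1
    have r2: "has_val (k + l) (r\<^sup>2)"
      unfolding r using ab 1 by (intro has_val_add[OF _ has_val_imp_ge[OF has_val_one]]) auto
    have "has_val (k + ((k + l) + 2*k)) (a*(r\<^sup>2*s\<^sup>2))" "has_val (k + (2*k + (k + l))) (c*(w\<^sup>2*r\<^sup>2))"
      by (intro has_val_mult a c r2 w2 s2)+
    moreover have "k + ((k + l) + 2*k) = l + (2*k + 2*k)" "k + (2*k + (k + l)) = l + (2*k + 2*k)" by simp_all
    ultimately have "has_val (l + (2*k + 2*k)) (a*(r\<^sup>2*s\<^sup>2))" "has_val (l + (2*k + 2*k)) (c*(w\<^sup>2*r\<^sup>2))"
      by metis+
    then show ?thesis
      using double has_val_add_three[OF _ bws] has_val_imp_ge bws by blast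
  next
    case 2
    have r2: "val_ge 1 (r\<^sup>2)"
      unfolding r using has_val_add_same[OF ab[unfolded 2] has_val_one] by simp
    have "val_ge (k + (2*k + 1)) (a*(s\<^sup>2*r\<^sup>2))" "val_ge (k + (2*k + 1)) (c*(w\<^sup>2*r\<^sup>2))"
      by (intro val_ge_mult r2 has_val_imp_ge a c w2 s2)+
    then have "val_ge (k + (2*k + 1)) (a*(r\<^sup>2*s\<^sup>2))" "val_ge (k + (2*k + 1)) (c*(w\<^sup>2*r\<^sup>2))"
      by (simp_all only: mult.commute)
    moreover have "l + (2*k + 2*k) < k + (2*k + 1)" using 2 by simp
    ultimately have "val_ge (l + (2*k + 2*k)) (a*(r\<^sup>2*s\<^sup>2))" "val_ge (l + (2*k + 2*k)) (c*(w\<^sup>2*r\<^sup>2))"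
      "has_val (l + (2*k + 2*k)) (b*(w\<^sup>2*s\<^sup>2) + (a*(r\<^sup>2*s\<^sup>2) + c*(w\<^sup>2*r\<^sup>2)))"
      using has_val_add[OF bws val_ge_add] by (auto intro: val_ge_mono)
    then show ?thesis
      using double has_val_imp_ge[OF bws] by (simp add: ac_simps)
  next
    case 3
    have r0: "has_val 0 r" and t0: "has_val 0 t"
      using has_val_sqrt_pos[OF r has_val_imp_ge[OF ab] 3] has_val_sqrt_pos[OF t has_val_imp_ge[OF bc] 3]
      by simp_all
    have l: "l > 2" using 3 k by simp
    obtain y where y: "y\<^sup>2 = b\<^sup>2 + 1" "has_val (2*l - 1) (y - 1)"
      using sqrt_near_one[OF w' b] l by auto
    then have y1: "val_ge 2 (y - 1)" using l by (auto intro: has_val_ge)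
    have rt: "val_ge 2 (r + t)"
    proof -
      have "s*(r + t) = - (r*t)" using rel by algebra
      then have "r + t = - (r*t) / s" using nz by (metis nonzero_mult_div_cancel_left)
      then have "has_val (0 + 0 - k) (r + t)"
        by (simp only:) (intro has_val_divide has_val_minus has_val_mult r0 t0 sk)
      then show ?thesis using k by (auto intro: has_val_ge)
    qed
    have one: "has_val 1 (x*2 + z)" if "has_val 0 x" "val_ge 2 z" for x z
      using has_val_add[OF has_val_mult[OF that(1) has_val_two] that(2)] by simp
    have ge: "val_ge 2 (x*z)" if "has_val 0 x" "val_ge 2 z" for x z
      using val_ge_mult[OF has_val_imp_ge[OF that(1)] that(2)] by simp
    \<comment> \<open>the seed \<open>P - B\<close>\<close>
    show ?thesis
    proof (rule seed_three_same)
      show "(y*t - r)\<^sup>2 - (r*t - y)\<^sup>2 = c*(b - a)*b\<^sup>2"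
      proof -
        have "(y*t - r)\<^sup>2 - (r*t - y)\<^sup>2 = (y\<^sup>2 - r\<^sup>2)*(t\<^sup>2 - 1)" by algebra
        then show ?thesis unfolding y r t by algebra
      qed
      show "(r*t - y)\<^sup>2 - (r*y - t)\<^sup>2 = a*(c - b)*b\<^sup>2"
      proof -
        have "(r*t - y)\<^sup>2 - (r*y - t)\<^sup>2 = (r\<^sup>2 - 1)*(t\<^sup>2 - y\<^sup>2)" by algebra
        then show ?thesis unfolding y r t by algebra
      qed
      show "b \<noteq> 0" by (rule nonzero)
      \<comment> \<open>Modulo 4, \<open>y\<close> is 1 and \<open>r\<close> is \<open>- t\<close>,
        so the three numerators reduce to \<open>2*t\<close>, \<open>-2\<close> and
        \<open>2*r\<close>.\<close>
      have "has_val 1 (t*2 + (t*(y - 1) - (r + t)))"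
        by (intro one t0 val_ge_diff ge y1 rt)
      then show "has_val 1 (y*t - r)" by (simp add: algebra_simps)
      have "has_val 1 (r*2 + (r*(y - 1) - (r + t)))"
        by (intro one r0 val_ge_diff ge y1 rt)
      then show "has_val 1 (r*y - t)" by (simp add: algebra_simps)
      have "val_ge 2 (r\<^sup>2 - 1)" using odd_square_minus_one[OF r0] val_ge_mono by auto
      then have "has_val 1 (- 1*2 + (r*(r + t) - (r\<^sup>2 - 1) - (y - 1)))"
        by (intro one has_val_minus[OF has_val_one] val_ge_diff[OF val_ge_diff[OF ge[OF r0 rt]] y1])
      then show "has_val 1 (r*t - y)" by (simp add: algebra_simps power2_eq_square)
    qed
  qed
qed

text \<open>If the least valuation is attained once or three times, \<open>a + b + c\<close> has it
  too and \<open>2P\<close> is a seed. The remaining cases are ties of exactly two elements.\<close>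

lemma seed_exists:
  assumes w: "w\<^sup>2 = a\<^sup>2 + 1" and w': "w'\<^sup>2 = b\<^sup>2 + 1"
  shows "admissible_seed a b c"
proof -
  obtain i j k where v: "has_val i a" "has_val j b" "has_val k c"
    using nonzero has_val_exists by metis
  \<comment> \<open>Exchanging \<open>a\<close> with \<open>b\<close> and \<open>s\<close> with
    \<open>t\<close> reduces a tie of \<open>b\<close> and \<open>c\<close> to one of
    \<open>a\<close> and \<open>c\<close>.\<close>
  interpret swap: order3_triple b a c r t s
    by unfold_locales (use nonzero distinct r s t rel in \<open>auto simp: ac_simps\<close>)
  consider "i = j" "j < k" | "i = k" "i < j" | "j = k" "j < i" | "i = j" "j = k"
    | "i < j" "i < k" | "j < i" "j < k" | "k < i" "k < j" by linarith
  then show ?thesis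
  proof cases
    case 1
    then show ?thesis using seed_ab_minimal[OF w w'] v by simp
  next
    case 2
    then show ?thesis using seed_ac_minimal[OF w w'] v by simp
  next
    case 3
    then show ?thesis using swap.seed_ac_minimal[OF w' w] v admissible_seed_commute by simp
  next
    case 4
    then show ?thesis using seed_double_zero v has_val_add_three has_val_imp_ge by metis
  next
    case 5
    then have "has_val i (a + (b + c))"
      by (intro has_val_add[where l = "i + 1"] v val_ge_add has_val_ge[OF v(2)] has_val_ge[OF v(3)]) auto
    then show ?thesis using 5 v
      by (intro seed_double_zero[of i]) (auto intro: has_val_ge simp: ac_simps)
  next
    case 6
    then have "has_val j (b + (a + c))"
      by (intro has_val_add[where l = "j + 1"] v val_ge_add has_val_ge[OF v(1)] has_val_ge[OF v(3)]) auto
    then show ?thesis using 6 v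
      by (intro seed_double_zero[of j]) (auto intro: has_val_ge simp: ac_simps)
  next
    case 7
    then have "has_val k (c + (a + b))"
      by (intro has_val_add[where l = "k + 1"] v val_ge_add has_val_ge[OF v(1)] has_val_ge[OF v(2)]) auto
    then show ?thesis using 7 v
      by (intro seed_double_zero[of k]) (auto intro: has_val_ge simp: ac_simps)
  qed
qed

end


section \<open>The three families\<close>

text \<open>On the curve the four-factor product is thus the square of
  \<open>2*(u*v + 1)*(u*v - u - v - 1)\<close>.\<close>

lemma curve_poly_factored:
  "curve_poly u v = 4*(u*v + 1)\<^sup>2*(u*v - u - v - 1)\<^sup>2
     - (u\<^sup>2 - 1)*(v\<^sup>2 - 1)*((u*v - u + v + 1)*(u*v + u - v + 1))"
  unfolding curve_poly_def by algebra

text \<open>\<open>a*c + 1\<close> and \<open>b*c + 1\<close> are squares identically in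
  \<open>u\<close> and \<open>v\<close>; the curve equation becomes \<open>key\<close>, which is
  \<open>rel\<close> solved for \<open>r\<close> and squared.\<close>

lemma F1_order3_triple:
  assumes "curve_poly u v = 0" "F1 u v = (Some a, Some b, Some c)"
    and "a \<noteq> 0" "b \<noteq> 0" "c \<noteq> 0" "a \<noteq> b" "a \<noteq> c" "b \<noteq> c"
  shows "(\<exists>r s t. order3_triple a b c r s t) \<and> is_square (a\<^sup>2 + 1) \<and> is_square (b\<^sup>2 + 1)"
proof -
  define D m n where "D = u*v - u - v - 1" and "m = u*v - u + v + 1" and "n = u*v + u - v + 1"
  define U V where "U = u\<^sup>2 - 1" and "V = v\<^sup>2 - 1"
  note defs = D_def m_def n_def U_def V_def
  have D': "- v + u*v - u - 1 = D" and U': "(u - 1)*(u + 1) = U" and V': "(v - 1)*(v + 1) = V"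
    and c': "2*(v - 1)*(v + 1)*(u - 1)*(u + 1) = 2*U*V"
    unfolding defs by algebra+
  have nz: "U \<noteq> 0" "V \<noteq> 0" "D \<noteq> 0"
    and abc: "a = 2*u / U" "b = 2*v / V" "c = 2*U*V / D\<^sup>2"
    using assms(2) unfolding F1_def partial_divide_def D' U' V' c'
    by (auto split: if_splits)
  have curve: "4*(u*v + 1)\<^sup>2*D\<^sup>2 = U*V*(m*n)"
    using assms(1) curve_poly_factored[of u v] unfolding defs by simp
  define s where "s = m / D"
  define t where "t = n / D"
  have s: "s\<^sup>2 = a*c + 1"
  proof -
    have "a*c = 4*u*V / D\<^sup>2" unfolding abc using nz by simp
    moreover have "m\<^sup>2 = 4*u*V + D\<^sup>2" unfolding defs by algebra
    ultimately show ?thesis unfolding s_def power_divide using nz by (simp add: add_divide_distrib)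
  qed
  have t: "t\<^sup>2 = b*c + 1"
  proof -
    have "b*c = 4*v*U / D\<^sup>2" unfolding abc using nz by simp
    moreover have "n\<^sup>2 = 4*v*U + D\<^sup>2" unfolding defs by algebra
    ultimately show ?thesis unfolding t_def power_divide using nz by (simp add: add_divide_distrib)
  qed
  have ab: "a*b + 1 = m*n / (U*V)"
  proof -
    have "m*n = 4*u*v + U*V" unfolding defs by algebra
    then show ?thesis unfolding abc using nz by (simp add: add_divide_distrib)
  qed
  have st: "s + t = 2*(u*v + 1) / D"
  proof -
    have "m + n = 2*(u*v + 1)" unfolding defs by algebra
    then show ?thesis unfolding s_def t_def by (metis add_divide_distrib)
  qed
  have key: "(a*b + 1)*(s + t)\<^sup>2 = (s*t)\<^sup>2"
  proof -
    have "(s + t)\<^sup>2 = 4*(u*v + 1)\<^sup>2*D\<^sup>2 / D^4"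
    proof -
      have "D\<^sup>2 \<noteq> 0" "D^4 \<noteq> 0" using nz by simp_all
      then show ?thesis unfolding st power_divide
        by (rule frac_eq_eq[THEN iffD2]) algebra
    qed
    also have "(a*b + 1)*\<dots> = (m*n)\<^sup>2 / D^4"
      unfolding ab curve using nz by (simp add: power2_eq_square)
    also have "\<dots> = (s*t)\<^sup>2"
      unfolding s_def t_def by (simp add: power_numeral_reduce power_divide)
    finally show ?thesis .
  qed
  have st0: "s + t \<noteq> 0"
  proof
    assume "s + t = 0"
    then have "s = 0 \<or> t = 0" using key by simp
    then have "s\<^sup>2 = t\<^sup>2" using \<open>s + t = 0\<close> by auto
    then have "a*c = b*c" using s t by linarith
    then show False using assms by simp
  qed
  \<comment> \<open>Solving \<open>rel\<close> for \<open>r\<close> selects the right sign, and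
    \<open>key\<close> shows that this is a root of \<open>a*b + 1\<close>.\<close>
  define r where "r = - (s*t) / (s + t)"
  have r': "r*(s + t) = - (s*t)" unfolding r_def using st0 by simp
  then have "r\<^sup>2*(s + t)\<^sup>2 = (a*b + 1)*(s + t)\<^sup>2" unfolding key by algebra
  then have "r\<^sup>2 = a*b + 1" using st0 by simp
  moreover have "r*s + r*t + s*t = 0" using r' by algebra
  ultimately have "order3_triple a b c r s t"
    by unfold_locales (use assms s t in auto)
  moreover have "a\<^sup>2 + 1 = ((u\<^sup>2 + 1) / U)\<^sup>2"
  proof -
    have "(u\<^sup>2 + 1)\<^sup>2 = (2*u)\<^sup>2 + U\<^sup>2" unfolding defs by algebra
    then show ?thesis unfolding abc power_divide using nz by (simp add: add_divide_distrib)
  qed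
  moreover have "b\<^sup>2 + 1 = ((v\<^sup>2 + 1) / V)\<^sup>2"
  proof -
    have "(v\<^sup>2 + 1)\<^sup>2 = (2*v)\<^sup>2 + V\<^sup>2" unfolding defs by algebra
    then show ?thesis unfolding abc power_divide using nz by (simp add: add_divide_distrib)
  qed
  ultimately show ?thesis by (metis is_nth_power_nth_power)
qed

lemma F2_order3_triple:
  assumes "curve_poly u v = 0" "F2 u v = (Some a, Some b, Some c)"
    and "a \<noteq> 0" "b \<noteq> 0" "c \<noteq> 0" "a \<noteq> b" "a \<noteq> c" "b \<noteq> c"
  shows "(\<exists>r s t. order3_triple a b c r s t) \<and> is_square (a\<^sup>2 + 1) \<and> is_square (b\<^sup>2 + 1)"
proof -
  define D m n where "D = u*v - u - v - 1" and "m = u*v - u + v + 1" and "n = u*v + u - v + 1"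
  define U V where "U = u\<^sup>2 - 1" and "V = v\<^sup>2 - 1"
  define A w where "A = u\<^sup>2 + 1" and "w = u*v + 1"
  define M where "M = u^3*v - u^3 - v - 1"
  note defs = D_def m_def n_def U_def V_def A_def w_def M_def
  have m': "u*v + v + 1 - u = m" and n': "u*v - v + u + 1 = n" and U': "(u - 1)*(u + 1) = U"
    unfolding defs by algebra+
  have nz: "U \<noteq> 0" "m \<noteq> 0" "n \<noteq> 0"
    and abc: "a = 2*u / U" "b = - (2*(u - v)*w) / (m*n)" "c = - (2*n*M) / (U*m\<^sup>2)"
    using assms(2) unfolding F2_def partial_divide_def m' n' U' M_def[symmetric] w_def[symmetric]
    by (auto split: if_splits)
  have curve: "4*w\<^sup>2*D\<^sup>2 = U*V*(m*n)"
    using assms(1) curve_poly_factored[of u v] unfolding defs by simp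
  have u0: "u \<noteq> 0" and w: "w \<noteq> 0" using assms(3,4) unfolding abc by auto
  \<comment> \<open>For \<open>v = 1\<close> the value of \<open>D\<close> is -2, for
    \<open>v = -1\<close> it is \<open>-2*u\<close>.\<close>
  have D: "D \<noteq> 0"
  proof
    assume "D = 0"
    then have "v\<^sup>2 = 1" using curve nz unfolding V_def by simp
    then have "v = 1 \<or> v = -1" by (simp add: power2_eq_1_iff)
    then show False using \<open>D = 0\<close> u0 unfolding D_def by auto
  qed
  have V: "V \<noteq> 0" using curve D w by auto
  \<comment> \<open>\<open>A\<^sup>2V/(Umn)\<close> is the rational function \<open>ab + 1\<close>; the curve equation turns it into a square\<close>
  define r where "r = A*V / (2*w*D)"
  define s where "s = - (A*D) / (U*m)"
  define t where "t = r*n / m"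
  have r2: "r\<^sup>2 = A\<^sup>2*V / (U*(m*n))"
  proof -
    have "r\<^sup>2 = A\<^sup>2*V\<^sup>2 / (4*w\<^sup>2*D\<^sup>2)" unfolding r_def power_divide by (simp add: power_mult_distrib)
    then show ?thesis unfolding curve using V by (simp add: power2_eq_square)
  qed
  have r: "r\<^sup>2 = a*b + 1"
  proof -
    have "A\<^sup>2*V = - (4*u*(u - v)*w) + U*(m*n)" unfolding defs by algebra
    then have "r\<^sup>2 = - (4*u*(u - v)*w) / (U*(m*n)) + 1"
      unfolding r2 using nz by (simp only: add_divide_distrib) simp
    also have "- (4*u*(u - v)*w) / (U*(m*n)) = a*b" unfolding abc by simp
    finally show ?thesis .
  qed
  have s: "s\<^sup>2 = a*c + 1"
  proof -
    have "(- (A*D))\<^sup>2 = - (4*u*n*M) + (U*m)\<^sup>2" unfolding defs by algebra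
    then have "s\<^sup>2 = - (4*u*n*M) / (U*m)\<^sup>2 + 1"
      unfolding s_def power_divide using nz by (simp only: add_divide_distrib) simp
    also have "- (4*u*n*M) / (U*m)\<^sup>2 = a*c" unfolding abc by (simp add: power2_eq_square ac_simps)
    finally show ?thesis .
  qed
  have t: "t\<^sup>2 = b*c + 1"
  proof -
    have "A\<^sup>2*V*n = 4*(u - v)*w*M + U*m^3" unfolding defs by algebra
    moreover have "t\<^sup>2 = A\<^sup>2*V*n / (U*m^3)"
      unfolding t_def power_divide power_mult_distrib r2
      using nz by (simp add: power2_eq_square power3_eq_cube)
    ultimately have "t\<^sup>2 = 4*(u - v)*w*M / (U*m^3) + 1"
      using nz by (simp only: add_divide_distrib) simp
    also have "4*(u - v)*w*M / (U*m^3) = b*c"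
    proof -
      have "U*m^3 \<noteq> 0" "m*n*(U*m\<^sup>2) \<noteq> 0" using nz by simp_all
      then show ?thesis unfolding abc times_divide_times_eq
        by (rule frac_eq_eq[THEN iffD2]) algebra
    qed
    finally show ?thesis .
  qed
  \<comment> \<open>With \<open>t*m = r*n\<close> and \<open>2*w = m + n\<close> the relation
    reduces to \<open>r*n + s*(2*w) = 0\<close>, which is the curve equation.\<close>
  have rel: "r*s + r*t + s*t = 0"
  proof -
    have rs: "r*(2*w*D) = A*V" "s*(U*m) = - (A*D)" "t*m = r*n"
      unfolding r_def s_def t_def using D w nz by simp_all
    have "(r*n + s*(2*w)) * (2*w*D*U*m) = (r*(2*w*D))*n*U*m + (s*(U*m))*(4*w\<^sup>2*D)" by algebra
    also have "\<dots> = A*(U*V*(m*n) - 4*w\<^sup>2*D\<^sup>2)" unfolding rs by algebra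
    also have "\<dots> = 0" unfolding curve by simp
    finally have "r*n + s*(2*w) = 0" using w D nz by simp
    moreover have "2*w = m + n" unfolding defs by simp
    moreover have "m*(r*s + r*t + s*t) = r*(s*m) + (r + s)*(t*m)" by algebra
    ultimately have "m*(r*s + r*t + s*t) = 0" unfolding rs by algebra
    then show ?thesis using nz by simp
  qed
  have "order3_triple a b c r s t"
    by unfold_locales (use assms r s t rel in auto)
  moreover have "a\<^sup>2 + 1 = (A / U)\<^sup>2"
  proof -
    have "A\<^sup>2 = (2*u)\<^sup>2 + U\<^sup>2" unfolding defs by algebra
    then show ?thesis unfolding abc power_divide using nz by (simp add: add_divide_distrib)
  qed
  moreover have "b\<^sup>2 + 1 = ((w\<^sup>2 + (u - v)\<^sup>2) / (m*n))\<^sup>2"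
  proof -
    have "(w\<^sup>2 + (u - v)\<^sup>2)\<^sup>2 = (- (2*(u - v)*w))\<^sup>2 + (m*n)\<^sup>2" unfolding defs by algebra
    then show ?thesis unfolding abc power_divide using nz by (simp only: add_divide_distrib) simp
  qed
  ultimately show ?thesis by (metis is_nth_power_nth_power)
qed

text \<open>The root conditions involve only products of two elements.\<close>

lemma order3_triple_uminus:
  "order3_triple (-a) (-b) (-c) r s t \<Longrightarrow> order3_triple a b c r s t"
  unfolding order3_triple_def by simp

text \<open>The curve is symmetric in \<open>u\<close> and \<open>v\<close>, and
  \<open>F3 u v\<close> is the entrywise negative of \<open>F2 v u\<close>.\<close>

lemma F3_order3_triple:
  assumes "curve_poly u v = 0" "F3 u v = (Some a, Some b, Some c)"
    and "a \<noteq> 0" "b \<noteq> 0" "c \<noteq> 0" "a \<noteq> b" "a \<noteq> c" "b \<noteq> c"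
  shows "(\<exists>r s t. order3_triple a b c r s t) \<and> is_square (a\<^sup>2 + 1) \<and> is_square (b\<^sup>2 + 1)"
proof -
  have "curve_poly v u = 0" using assms(1) unfolding curve_poly_def by algebra
  moreover have "F2 v u = (Some (-a), Some (-b), Some (-c))"
  proof -
    define m n M V where "m = u*v + v + 1 - u" and "n = u*v - v + u + 1"
      and "M = v^3*u - v^3 - u - 1" and "V = (v - 1)*(v + 1)"
    have e: "v*u + u + 1 - v = n" "v*u - u + v + 1 = m" "v*u + 1 = u*v + 1"
      "n\<^sup>2*(v + 1)*(v - 1) = V*n\<^sup>2" "2*(v - u)*(u*v + 1) = - (2*(u - v)*(u*v + 1))"
      unfolding m_def n_def V_def by algebra+
    show ?thesis using assms(2)
      unfolding F2_def F3_def partial_divide_def m_def[symmetric] n_def[symmetric]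
        M_def[symmetric] e V_def[symmetric]
      by (auto simp: mult.commute split: if_splits)
  qed
  ultimately have "(\<exists>r s t. order3_triple (-a) (-b) (-c) r s t)
      \<and> is_square ((-a)\<^sup>2 + 1) \<and> is_square ((-b)\<^sup>2 + 1)"
    by (rule F2_order3_triple) (use assms in auto)
  then show ?thesis by (metis order3_triple_uminus power2_minus)
qed

theorem theorem1:
  fixes u v a b c :: rat
    and F :: "rat \<Rightarrow> rat \<Rightarrow> partial_triple"
  assumes "(u, v) \<in> C_rational_points"
    and "F \<in> {F1, F2, F3}"
    and "F u v = (Some a, Some b, Some c)"
    and "a \<noteq> b" and "a \<noteq> c" and "b \<noteq> c"
    and "a \<noteq> 0" and "b \<noteq> 0" and "c \<noteq> 0"
  shows "rational_diophantine_tuple 3 {a, b, c}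
    \<and> strong_diophantine_tuple 2 {a, b}
    \<and> infinite {{d, e, f} | d e f. rational_diophantine_tuple 6 {a, b, c, d, e, f}}"
proof -
  have "curve_poly u v = 0" using assms(1) unfolding C_rational_points_def by simp
  then have *: "(\<exists>r s t. order3_triple a b c r s t) \<and> is_square (a\<^sup>2 + 1) \<and> is_square (b\<^sup>2 + 1)"
    using assms(2-9) F1_order3_triple F2_order3_triple F3_order3_triple by blast
  then obtain r s t where "order3_triple a b c r s t" by blast
  then interpret order3_triple a b c r s t .
  obtain w w' where w: "w\<^sup>2 = a\<^sup>2 + 1" "w'\<^sup>2 = b\<^sup>2 + 1"
    using * by (metis is_nth_power_def)
  have "infinite admissible"
    unfolding admissible_def using infinite_admissible[OF seed_exists[OF w] nonzero] .
  then have "infinite {{d, e, f} | d e f. rational_diophantine_tuple 6 {a, b, c, d, e, f}}"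
    by (rule infinite_sextuples)
  moreover have "strong_diophantine_tuple 2 {a, b}"
    using * triple_is_diophantine assms(4)
    unfolding strong_diophantine_tuple_def rational_diophantine_tuple_def by auto
  ultimately show ?thesis using triple_is_diophantine by blast
qed

end
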